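(* Let $T$ be a countable set, $\alpha>0$, and let $\{X_t,t\in T\}$ be an associated $\alpha$-permanental process with kernel $\{u(s,t),s,t\in T\}$. For distinct $t_1,\dots,t_n\in T$ let $a_i(t_1,\dots,t_n)$, $i=1,\dots,n$, be the diagonal elements of $\left(\{u(t_i,t_j)\}_{i,j=1}^n\right)^{-1}$. Let $d=d_{s,t}$ be a non-negative function on $T\times T$ and set $$d_n^*(t_1,\dots,t_n)=\inf_{1\le i,j\le n,\ i\ne j}d_{t_i,t_j}.$$ Suppose that there are a constant $C'$ and an integer $p\ge 1$ such that, for all $n\ge p$ with $n\geq 2$ and all distinct $t_1,\dots,t_n\in T$, the inequality $$a_i(t_1,\dots,t_n)\le\frac{C'}{(d_n^* )^2(t_1,\dots,t_n)}$$ holds for at least $[n/p]$ of the indices $i\in\{1,\dots,n\}$ (that is, for a fixed fraction of the entries). Then $$\limsup_{n\to\infty}\left(\sup_{(t_1,\dots,t_n)}(d_n^* )^2(t_1,\dots,t_n)\right)\log n=\infty$$ (supremum over $n$-tuples of distinct elements of $T$) implies that $\sup_{t\in T}X_t=\infty$ almost surely.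
   Context: For $\alpha>0$, an $\alpha$-permanental process with kernel $\{u(s,t),s,t\in T\}$ is a non-negative stochastic process $\{X_t,t\in T\}$ such that for all $t_1,\dots,t_n\in T$ and $s_1,\dots,s_n\ge 0$, $E\left(e^{-\sum_i s_iX_{t_i}}\right)=|I+KS|^{-\alpha}$ with $K=\{u(t_i,t_j)\}_{i,j=1}^n$, $S=\mathrm{diag}(s_1,\dots,s_n)$ and $|\cdot|$ the determinant. It is called an associated $\alpha$-permanental process if $u$ is the potential density of a transient Markov process with state space $T$; the process is taken to have local times $L^y_t$ normalized so that $u(x,y)=E^x(L^y_\infty)<\infty$. It is a known fact that for such $u$ an $\alpha$-permanental process with kernel $u$ exists for every $\alpha>0$, and that for distinct $t_1,\dots,t_n\in T$ the matrix $\{u(t_i,t_j)\}_{i,j=1}^n$ is invertible and its inverse is a nonsingular $M$-matrix (off-diagonal entries $\le 0$, inverse entrywise $\ge 0$). $[\cdot]$ denotes integer part. An upper bound $C'/0$ is read as $+\infty$; the supremum of non-negative quantities over the empty set is $0$. *)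

theory Defs
  imports
    "HOL-Probability.Probability"
    "Jordan_Normal_Form.Determinant"
    "Jordan_Normal_Form.Gauss_Jordan_Elimination"
begin

section \<open>Permanental processes\<close>

definition kernel_mat :: "('a \<Rightarrow> 'a \<Rightarrow> real) \<Rightarrow> nat \<Rightarrow> (nat \<Rightarrow> 'a) \<Rightarrow> real mat" where
  "kernel_mat u n t = Matrix.mat n n (\<lambda>(i, j). u (t i) (t j))"

text \<open>The points \<open>t 0, \<dots>, t (n - 1)\<close> need not be distinct, and \<open>u\<close> is not assumed symmetric.
  The determinant is automatically positive, since it equals 1 for \<open>s = 0\<close>, is continuous in
  \<open>s\<close>, and cannot vanish because \<open>0 powr (- \<alpha>) = 0\<close> whereas the expectation is positive.\<close>

definition permanental_process ::
    "'w measure \<Rightarrow> 'a set \<Rightarrow> real \<Rightarrow> ('a \<Rightarrow> 'a \<Rightarrow> real) \<Rightarrow> ('a \<Rightarrow> 'w \<Rightarrow> real) \<Rightarrow> bool" where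
  "permanental_process M T \<alpha> u X \<longleftrightarrow>
     prob_space M \<and>
     (\<forall>t\<in>T. X t \<in> borel_measurable M \<and> (\<forall>\<omega>\<in>space M. 0 \<le> X t \<omega>)) \<and>
     (\<forall>(n::nat) (t :: nat \<Rightarrow> 'a) (s :: nat \<Rightarrow> real).
        (\<forall>i<n. t i \<in> T) \<longrightarrow> (\<forall>i<n. 0 \<le> s i) \<longrightarrow>
        (\<integral>\<omega>. exp (- (\<Sum>i<n. s i * X (t i) \<omega>)) \<partial>M) =
          Determinant.det (1\<^sub>m n + kernel_mat u n t * mat_diag n s) powr (- \<alpha>))"


section \<open>Right-continuous strong Markov processes with countable state space\<close>

text \<open>The state space is \<open>topspace E\<close> for a metrizable topology \<open>E\<close>, which need not be discrete.
  Processes live on the canonical path space: a path sends each time in \<open>{0..}\<close> to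
  \<open>Some\<close> state, or to the absorbing cemetery \<open>None\<close>, and \<open>undefined\<close> outside \<open>{0..}\<close>.
  The lifetime \<open>\<zeta>\<close> is the first time at which the path is \<open>None\<close>; the second condition on paths is
  right-continuity on \<open>[0, \<zeta>)\<close> and makes the set of times before death half-open.\<close>

type_synonym 'a path = "real \<Rightarrow> 'a option"

definition paths :: "'a topology \<Rightarrow> 'a path set" where
  "paths E = {\<omega> \<in> {0..} \<rightarrow>\<^sub>E insert None (Some ` topspace E).
     (\<forall>s t. 0 \<le> s \<and> s \<le> t \<and> \<omega> s = None \<longrightarrow> \<omega> t = None) \<and>
     (\<forall>t x U. 0 \<le> t \<and> \<omega> t = Some x \<and> openin E U \<and> x \<in> U \<longrightarrow>
        (\<forall>\<^sub>F s in at_right t. \<omega> s \<in> Some ` U))}"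

text \<open>All subsets of the state space are taken as measurable. This is the Borel
  \<open>\<sigma>\<close>-algebra exactly because the state spaces considered are countable (and metrizable).\<close>

definition path_algebra :: "'a topology \<Rightarrow> 'a path measure" where
  "path_algebra E = sigma (paths E) {{\<omega> \<in> paths E. \<omega> s \<in> B} | s B. 0 \<le> s}"

definition history :: "'a topology \<Rightarrow> real \<Rightarrow> 'a path measure" where
  "history E t = sigma (paths E) {{\<omega> \<in> paths E. \<omega> s \<in> B} | s B. 0 \<le> s \<and> s \<le> t}"

text \<open>The right-continuous filtration \<open>\<F>\<^bsub>t+\<^esub>\<close>, with \<open>\<F>\<^bsub>\<infinity>\<^esub>\<close> the full path \<open>\<sigma>\<close>-algebra.\<close>

definition history_plus :: "'a topology \<Rightarrow> ennreal \<Rightarrow> 'a path measure" where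
  "history_plus E t =
     sigma (paths E) (sets (path_algebra E) \<inter> (\<Inter>r\<in>{r. t < ennreal r}. sets (history E r)))"

definition shift :: "real \<Rightarrow> 'a path \<Rightarrow> 'a path" where
  "shift t \<omega> = (\<lambda>s\<in>{0..}. \<omega> (t + s))"

text \<open>\<open>P x\<close> is the law of the process started at \<open>x\<close>. After the lifetime a path is constantly
  \<open>None\<close>, so the strong Markov property only has content on \<open>{S < \<zeta>}\<close>, which is the set
  \<open>{\<omega>. S \<omega> < \<infinity> \<and> \<omega> (S \<omega>) \<noteq> None}\<close>; no law needs to be given for the cemetery.\<close>

locale right_process =
  fixes E :: "'a topology" and P :: "'a \<Rightarrow> 'a path measure"
  assumes countable_states: "countable (topspace E)"
    and metrizable: "metrizable_space E"
    and prob: "\<And>x. x \<in> topspace E \<Longrightarrow> prob_space (P x)"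
    and sets_P: "\<And>x. x \<in> topspace E \<Longrightarrow> sets (P x) = sets (path_algebra E)"
    and start: "\<And>x. x \<in> topspace E \<Longrightarrow> AE \<omega> in P x. \<omega> 0 = Some x"
    and strong_markov:
      "\<And>x (S :: 'a path \<Rightarrow> ennreal) A B.
         \<lbrakk>x \<in> topspace E;
          stopping_time (history_plus E) S;
          A \<in> sets (filtration.pre_sigma (paths E) (history_plus E) S);
          B \<in> sets (path_algebra E)\<rbrakk> \<Longrightarrow>
         emeasure (P x)
           {\<omega> \<in> A. S \<omega> < \<infinity> \<and> \<omega> (enn2real (S \<omega>)) \<noteq> None \<and> shift (enn2real (S \<omega>)) \<omega> \<in> B} =
         (\<integral>\<^sup>+\<omega>\<in>{\<omega> \<in> A. S \<omega> < \<infinity> \<and> \<omega> (enn2real (S \<omega>)) \<noteq> None}.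
            emeasure (P (the (\<omega> (enn2real (S \<omega>))))) B \<partial>P x)"


section \<open>Potentials and local times\<close>

text \<open>\<open>U f (x) = E\<^sup>x \<integral>\<^sub>0\<^sup>\<zeta> f(X\<^sub>t) dt\<close>\<close>

definition potential :: "('a \<Rightarrow> 'a path measure) \<Rightarrow> ('a \<Rightarrow> ennreal) \<Rightarrow> 'a \<Rightarrow> ennreal" where
  "potential P f x =
     (\<integral>\<^sup>+\<omega>. (\<integral>\<^sup>+t\<in>{0..}. (case \<omega> t of None \<Rightarrow> 0 | Some y \<Rightarrow> f y) \<partial>lborel) \<partial>P x)"

definition transient :: "'a topology \<Rightarrow> ('a \<Rightarrow> 'a path measure) \<Rightarrow> bool" where
  "transient E P \<longleftrightarrow>
     (\<exists>h :: 'a \<Rightarrow> real. (\<forall>y\<in>topspace E. 0 < h y) \<and>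
        (\<forall>x\<in>topspace E. potential P (\<lambda>y. ennreal (h y)) x < \<infinity>))"

definition potential_density ::
    "'a topology \<Rightarrow> ('a \<Rightarrow> 'a path measure) \<Rightarrow> ('a \<Rightarrow> 'a \<Rightarrow> real) \<Rightarrow> bool" where
  "potential_density E P u \<longleftrightarrow>
     (\<forall>x\<in>topspace E. \<forall>y\<in>topspace E. 0 \<le> u x y) \<and>
     (\<exists>m :: 'a measure. sigma_finite_measure m \<and> sets m = Pow (topspace E) \<and>
        (\<forall>x\<in>topspace E. \<forall>A. A \<subseteq> topspace E \<longrightarrow>
           potential P (indicator A) x = (\<integral>\<^sup>+y\<in>A. ennreal (u x y) \<partial>m)))"

text \<open>Continuous additive functionals. The measurability condition is adaptedness to the usual
  augmentation of \<open>\<F>\<^bsub>t+\<^esub>\<close> under each \<open>P x\<close>; the condition with \<open>None\<close> says that \<open>L\<close> stops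
  growing at the lifetime.\<close>

definition continuous_additive_functional ::
    "'a topology \<Rightarrow> ('a \<Rightarrow> 'a path measure) \<Rightarrow> (real \<Rightarrow> 'a path \<Rightarrow> real) \<Rightarrow> bool" where
  "continuous_additive_functional E P L \<longleftrightarrow>
     (\<forall>x\<in>topspace E.
        (\<forall>t\<ge>0. \<exists>g\<in>borel_measurable (history_plus E (ennreal t)). AE \<omega> in P x. L t \<omega> = g \<omega>) \<and>
        (AE \<omega> in P x.
           L 0 \<omega> = 0 \<and> continuous_on {0..} (\<lambda>t. L t \<omega>) \<and> mono_on {0..} (\<lambda>t. L t \<omega>) \<and>
           (\<forall>s t. 0 \<le> s \<and> s \<le> t \<and> \<omega> s = None \<longrightarrow> L t \<omega> = L s \<omega>) \<and>
           (\<forall>s t. 0 \<le> s \<and> 0 \<le> t \<longrightarrow> L (t + s) \<omega> = L t \<omega> + L s (shift t \<omega>))))"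

text \<open>With \<open>R = inf {t > 0. L\<^sub>t > 0}\<close>, a local time at \<open>y\<close> is a continuous additive functional such
  that \<open>P\<^sup>y(R = 0) = 1\<close> and \<open>P\<^sup>x(R = 0) = 0\<close> for all \<open>x \<noteq> y\<close>.\<close>

definition local_time_at ::
    "'a topology \<Rightarrow> ('a \<Rightarrow> 'a path measure) \<Rightarrow> 'a \<Rightarrow> (real \<Rightarrow> 'a path \<Rightarrow> real) \<Rightarrow> bool" where
  "local_time_at E P y L \<longleftrightarrow>
     continuous_additive_functional E P L \<and>
     (AE \<omega> in P y. \<forall>t>0. 0 < L t \<omega>) \<and>
     (\<forall>x\<in>topspace E. x \<noteq> y \<longrightarrow> (AE \<omega> in P x. \<exists>t>0. L t \<omega> = 0))"

definition markov_potential_density :: "'a set \<Rightarrow> ('a \<Rightarrow> 'a \<Rightarrow> real) \<Rightarrow> bool" where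
  "markov_potential_density T u \<longleftrightarrow>
     (\<exists>(E :: 'a topology) (P :: 'a \<Rightarrow> 'a path measure) (L :: 'a \<Rightarrow> real \<Rightarrow> 'a path \<Rightarrow> real).
        topspace E = T \<and> right_process E P \<and> transient E P \<and> potential_density E P u \<and>
        (\<forall>y\<in>T. local_time_at E P y (L y)) \<and>
        (\<forall>x\<in>T. \<forall>y\<in>T.
           (\<integral>\<^sup>+\<omega>. (SUP t\<in>{0..}. ennreal (L y t \<omega>)) \<partial>P x) = ennreal (u x y)))"

definition associated_permanental_process ::
    "'w measure \<Rightarrow> 'a set \<Rightarrow> real \<Rightarrow> ('a \<Rightarrow> 'a \<Rightarrow> real) \<Rightarrow> ('a \<Rightarrow> 'w \<Rightarrow> real) \<Rightarrow> bool" where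
  "associated_permanental_process M T \<alpha> u X \<longleftrightarrow>
     permanental_process M T \<alpha> u X \<and> markov_potential_density T u"


section \<open>Tuples of distinct points\<close>

text \<open>Tuples are indexed from 0, and only the values on \<open>{..<n}\<close> matter.\<close>

definition distinct_tuples :: "'a set \<Rightarrow> nat \<Rightarrow> (nat \<Rightarrow> 'a) set" where
  "distinct_tuples T n = {t. t ` {..<n} \<subseteq> T \<and> inj_on t {..<n}}"

definition inverse_diag :: "('a \<Rightarrow> 'a \<Rightarrow> real) \<Rightarrow> nat \<Rightarrow> (nat \<Rightarrow> 'a) \<Rightarrow> nat \<Rightarrow> real" where
  "inverse_diag u n t i = the (mat_inverse (kernel_mat u n t)) $$ (i, i)"

text \<open>Only meaningful for \<open>n \<ge> 2\<close>: for smaller \<open>n\<close> this is the unspecified real \<open>Inf {}\<close>.\<close>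

definition dstar :: "('a \<Rightarrow> 'a \<Rightarrow> real) \<Rightarrow> nat \<Rightarrow> (nat \<Rightarrow> 'a) \<Rightarrow> real" where
  "dstar d n t = (INF (i, j)\<in>{(i, j). i < n \<and> j < n \<and> i \<noteq> j}. d (t i) (t j))"

end

theory Submission
  imports Defs "HOL-Real_Asymp.Real_Asymp"
begin

text \<open>The strong Markov property at the first time one of the points \<open>t\<^sub>j\<close>, \<open>j \<noteq> i\<close>, is hit expresses
  row \<open>i\<close> of \<open>K = {u(t\<^sub>i, t\<^sub>j)}\<close> as a non-negative combination of the other rows plus a positive
  multiple of the \<open>i\<close>-th unit vector. Hence \<open>K\<close> has an inverse \<open>A\<close> with non-positive
  off-diagonal entries. Gaussian elimination then expands \<open>|A + S|\<^sup>-\<^sup>\<alpha>\<close> as a limit of non-negative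
  combinations of products of \<open>(A\<^sub>i\<^sub>i + s\<^sub>i)\<close> to the powers \<open>-\<alpha> - k\<^sub>i\<close>, so that the permanental vector is a
  mixture of independent gamma vectors with rates \<open>A\<^sub>i\<^sub>i\<close> and shapes at least \<open>\<alpha>\<close>. All its
  components are at most \<open>L\<close> with probability at most a product of gamma distribution functions, which
  tends to 0 along tuples with \<open>(d\<^sub>n\<^sup>*)\<^sup>2 log n\<close> unbounded.\<close>

subsection \<open>The strong Markov property at a random time\<close>

text \<open>The kernel may be non-symmetric and \<open>\<alpha>\<close> is arbitrary, so Gaussian
  comparison is not at hand; only the sign pattern of the inverse kernel drives the argument.
  Elimination preserves the rates: every matrix that occurs has the form diag(a_i + s_i) - b with b
  in the cone, and each pivot contributes exactly one factor to the power \<open>-\<alpha>\<close>,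
  which is why no shape falls below \<open>\<alpha>\<close>. Raising a shape only moves mass
  upwards, so the unknown mixing weights drop out of the bound. The logarithm comes from the gamma
  tail: at rate a and level L + 1 it is at least a constant times exp(-2a(L + 1)). With a of order
  (log n)/q and q large this is at least of order n^(-1/2), and about n/p coordinates contribute a
  factor 1 - c n^(-1/2) each, so the product is at most of order exp(-c' sqrt n). On the Markov side
  the obstacles are of measurability: local times are adapted only up to null sets that depend on
  the starting law, and the topology of the state space need not be discrete, so that evaluating a
  path at a random time rests on right-continuity.\<close>

lemma space_path_algebra [simp]: "space (path_algebra E) = paths E"
  unfolding path_algebra_def by (rule space_measure_of) auto

lemma space_history [simp]: "space (history E t) = paths E"
  unfolding history_def by (rule space_measure_of) auto

lemma paths_measurable [simp]: "paths E \<in> sets (path_algebra E)" "paths E \<in> sets (history E t)"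
  using sets.top[of "path_algebra E"] sets.top[of "history E t"] by simp_all

lemma coordinate_measurable:
  "0 \<le> s \<Longrightarrow> {\<omega> \<in> paths E. \<omega> s \<in> B} \<in> sets (path_algebra E)"
  unfolding path_algebra_def by (subst sets_measure_of) auto

lemma history_plus_generators:
  "sets (path_algebra E) \<inter> (\<Inter>r\<in>{r. t < ennreal r}. sets (history E r)) \<subseteq> Pow (paths E)"
  using sets.space_closed[of "path_algebra E"] by auto

lemma space_history_plus [simp]: "space (history_plus E t) = paths E"
  unfolding history_plus_def using history_plus_generators by (rule space_measure_of)

lemma sets_history_plus:
  "sets (history_plus E t) =
     sigma_sets (paths E) (sets (path_algebra E) \<inter> (\<Inter>r\<in>{r. t < ennreal r}. sets (history E r)))"
  unfolding history_plus_def using history_plus_generators by (rule sets_measure_of)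

lemma history_plusI:
  assumes "A \<in> sets (path_algebra E)" "\<And>r. t < ennreal r \<Longrightarrow> A \<in> sets (history E r)"
  shows "A \<in> sets (history_plus E t)"
  unfolding sets_history_plus using assms by auto

lemma history_plus_path_algebra: "sets (history_plus E t) \<subseteq> sets (path_algebra E)"
  unfolding sets_history_plus
  by (rule sets.sigma_sets_subset[of _ "path_algebra E", simplified]) auto

lemma history_plusD:
  assumes "A \<in> sets (history_plus E t)" "t < ennreal r"
  shows "A \<in> sets (history E r)"
proof -
  have "sigma_sets (space (history E r))
      (sets (path_algebra E) \<inter> (\<Inter>r\<in>{r. t < ennreal r}. sets (history E r))) \<subseteq> sets (history E r)"
    by (rule sets.sigma_sets_subset) (use assms(2) in auto)
  with assms(1) show ?thesis by (auto simp: sets_history_plus)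
qed

lemma filtration_history_plus: "filtration (paths E) (history_plus E)"
proof
  fix s t :: ennreal assume "s \<le> t"
  show "sets (history_plus E s) \<subseteq> sets (history_plus E t)"
  proof
    fix A assume A: "A \<in> sets (history_plus E s)"
    show "A \<in> sets (history_plus E t)"
    proof (rule history_plusI)
      show "A \<in> sets (path_algebra E)" using A history_plus_path_algebra by blast
      show "A \<in> sets (history E r)" if "t < ennreal r" for r
        using history_plusD[OF A order.strict_trans1[OF \<open>s \<le> t\<close> that]] .
    qed
  qed
qed simp

lemma measurable_history_plus_path_algebra:
  "f \<in> borel_measurable (history_plus E t) \<Longrightarrow> f \<in> borel_measurable (path_algebra E)"
  using history_plus_path_algebra[of E t] by (auto simp: measurable_def)

text \<open>Restricting to rational times keeps everything countable. It loses nothing in the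
  intended case \<open>D q\<close> = {L_q > 0} with L continuous and increasing.\<close>

definition debut :: "(real \<Rightarrow> 'a path set) \<Rightarrow> 'a path \<Rightarrow> ennreal" where
  "debut D \<omega> = Inf {ennreal q | q. q \<in> \<rat> \<and> 0 \<le> q \<and> \<omega> \<in> D q}"

text \<open>An infimum may be approached from above, so {\<open>debut D\<close> at most t} is
  decided only immediately after t. This is why the right-continuous filtration is used.\<close>

lemma stopping_time_debut:
  assumes D: "\<And>q. q \<in> \<rat> \<Longrightarrow> 0 \<le> q \<Longrightarrow> D q \<in> sets (history_plus E (ennreal q))"
  shows "stopping_time (history_plus E) (debut D)"
proof
  fix t :: ennreal
  let ?A = "{\<omega> \<in> paths E. debut D \<omega> \<le> t}"
  have hist: "?A \<in> sets (history E r)" if r: "t < ennreal r" for r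
  proof -
    let ?R = "{r' \<in> \<rat>. t < ennreal r' \<and> r' \<le> r}"
    let ?B = "\<Inter>r'\<in>?R. \<Union>q\<in>{q \<in> \<rat>. 0 \<le> q \<and> q < r'}. D q"
    \<comment> \<open>The cap \<open>r' \<le> r\<close> in \<open>?R\<close> costs nothing, since
      only \<open>r'\<close> close to t matter, and it keeps all times involved below r.\<close>
    have "?A = {\<omega> \<in> paths E. \<forall>r'\<in>?R. \<exists>q\<in>{q \<in> \<rat>. 0 \<le> q \<and> q < r'}. \<omega> \<in> D q}"
    proof (intro Collect_cong conj_cong refl iffI ballI)
      fix \<omega> r' assume "debut D \<omega> \<le> t" "r' \<in> ?R"
      then have "debut D \<omega> < ennreal r'" by auto
      then obtain q where "q \<in> \<rat>" "0 \<le> q" "\<omega> \<in> D q" "ennreal q < ennreal r'"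
        by (auto simp: debut_def Inf_less_iff)
      then show "\<exists>q\<in>{q \<in> \<rat>. 0 \<le> q \<and> q < r'}. \<omega> \<in> D q"
        by (auto simp: ennreal_less_iff)
    next
      fix \<omega> assume *: "\<forall>r'\<in>?R. \<exists>q\<in>{q \<in> \<rat>. 0 \<le> q \<and> q < r'}. \<omega> \<in> D q"
      show "debut D \<omega> \<le> t"
      proof (rule ccontr)
        assume "\<not> debut D \<omega> \<le> t"
        then have "t < min (debut D \<omega>) (ennreal r)" using r by auto
        then obtain r' :: rat where r': "t < real_of_rat r'" "real_of_rat r' < min (debut D \<omega>) (ennreal r)"
          using ennreal_rat_dense by blast
        have "real_of_rat r' \<le> r"
        proof (rule ccontr)
          assume "\<not> real_of_rat r' \<le> r"
          then have "ennreal r \<le> ennreal (real_of_rat r')" by (intro ennreal_leI) simp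
          moreover have "ennreal (real_of_rat r') < ennreal r" using r'(2) by simp
          ultimately show False by (rule leD[THEN notE])
        qed
        with r'(1) have "real_of_rat r' \<in> ?R" by auto
        then obtain q where "q \<in> \<rat>" "0 \<le> q" "q < real_of_rat r'" "\<omega> \<in> D q" using * by blast
        then have "debut D \<omega> \<le> ennreal q" "ennreal q \<le> ennreal (real_of_rat r')"
          by (auto simp: debut_def intro!: Inf_lower ennreal_leI)
        then have "debut D \<omega> \<le> ennreal (real_of_rat r')" by (rule order.trans)
        moreover have "ennreal (real_of_rat r') < debut D \<omega>" using r'(2) by simp
        ultimately show False by (rule leD[THEN notE])
      qed
    qed
    also have "\<dots> \<in> sets (history E r)"
    proof -
      have "D q \<in> sets (history E r)" if "q \<in> \<rat>" "0 \<le> q" "q < r" for q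
        using history_plusD[OF D] that by (simp add: ennreal_less_iff)
      then have "{\<omega> \<in> space (history E r). \<omega> \<in> D q} \<in> sets (history E r)" if "q \<in> \<rat>" "0 \<le> q" "q < r" for q
        using that by (simp add: Collect_conj_eq Int_def[symmetric] del: space_history)
      then have "{\<omega> \<in> space (history E r). \<forall>r'\<in>?R. \<exists>q\<in>{q \<in> \<rat>. 0 \<le> q \<and> q < r'}. \<omega> \<in> D q} \<in> sets (history E r)"
        by (intro sets.sets_Collect_countable_All' sets.sets_Collect_countable_Ex')
           (auto intro: countable_subset[OF _ countable_rat])
      then show ?thesis by simp
    qed
    finally show ?thesis .
  qed
  \<comment> \<open>Required separately: for \<open>t = \<top>\<close> there is no r with
    \<open>t < ennreal r\<close>, and the intersection over r says nothing.\<close>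
  have "?A \<in> sets (path_algebra E)"
  proof (cases "t = \<top>")
    case True
    then show ?thesis using sets.top[of "path_algebra E"] by simp
  next
    case False
    have meas: "D q \<in> sets (path_algebra E)" if "q \<in> \<rat>" "0 \<le> q" for q
      using D[OF that] history_plus_path_algebra by blast
    have "debut D \<in> borel_measurable (path_algebra E)"
    proof -
      have eq: "debut D = (\<lambda>\<omega>. INF q\<in>{q \<in> \<rat>. 0 \<le> q}. if \<omega> \<in> D q then ennreal q else \<top>)"
      proof
        fix \<omega> show "debut D \<omega> = (INF q\<in>{q \<in> \<rat>. 0 \<le> q}. if \<omega> \<in> D q then ennreal q else \<top>)"
          unfolding debut_def
          by (intro antisym Inf_greatest INF_greatest) (auto intro: Inf_lower INF_lower2)
      qed
      have "countable {q :: real. q \<in> \<rat> \<and> 0 \<le> q}"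
        by (rule countable_subset[OF _ countable_rat]) auto
      then show ?thesis
        unfolding eq
        by (intro borel_measurable_INF measurable_If_set sets.Int meas) auto
    qed
    then have "{\<omega> \<in> space (path_algebra E). debut D \<omega> \<le> t} \<in> sets (path_algebra E)" by measurable
    then show ?thesis by simp
  qed
  then have "?A \<in> sets (history_plus E t)"
    using hist by (rule history_plusI)
  then show "Measurable.pred (history_plus E t) (\<lambda>\<omega>. debut D \<omega> \<le> t)"
    by (simp add: Measurable.pred_def)
qed

section \<open>Canonical paths, their shifts and their values at random times\<close>

lemma path_values:
  "\<omega> \<in> paths E \<Longrightarrow> 0 \<le> t \<Longrightarrow> \<omega> t \<in> insert None (Some ` topspace E)"
  unfolding paths_def by (blast dest: PiE_mem[of _ _ _ t])

lemma path_dead: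
  "\<omega> \<in> paths E \<Longrightarrow> 0 \<le> s \<Longrightarrow> s \<le> t \<Longrightarrow> \<omega> s = None \<Longrightarrow> \<omega> t = None"
  unfolding paths_def by blast

lemma path_right_continuous:
  "\<omega> \<in> paths E \<Longrightarrow> 0 \<le> t \<Longrightarrow> \<omega> t = Some x \<Longrightarrow> openin E U \<Longrightarrow> x \<in> U \<Longrightarrow>
    \<forall>\<^sub>F s in at_right t. \<omega> s \<in> Some ` U"
  unfolding paths_def by blast

lemma shift_in_paths:
  assumes \<omega>: "\<omega> \<in> paths E" and t: "0 \<le> t"
  shows "shift t \<omega> \<in> paths E"
proof -
  have "\<forall>\<^sub>F s in at_right r. shift t \<omega> s \<in> Some ` U"
    if r: "0 \<le> r" "shift t \<omega> r = Some x" "openin E U" "x \<in> U" for r x U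
  proof -
    have "\<forall>\<^sub>F s in at_right (t + r). \<omega> s \<in> Some ` U"
      using path_right_continuous[OF \<omega>, of "t + r" x U] t r by (simp add: shift_def)
    then obtain b where "t + r < b" "\<And>s. t + r < s \<Longrightarrow> s < b \<Longrightarrow> \<omega> s \<in> Some ` U"
      by (auto simp: eventually_at_right_field)
    then show ?thesis
      unfolding eventually_at_right_field
      using r(1) by (intro exI[of _ "b - t"]) (simp add: shift_def)
  qed
  moreover have "shift t \<omega> \<in> {0..} \<rightarrow>\<^sub>E insert None (Some ` topspace E)"
    unfolding shift_def restrict_PiE_iff using path_values[OF \<omega>] t by (intro ballI) simp
  moreover have "shift t \<omega> s' = None" if "0 \<le> s" "s \<le> s'" "shift t \<omega> s = None" for s s'
    using path_dead[OF \<omega>, of "t + s" "t + s'"] t that by (simp add: shift_def)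
  ultimately show ?thesis unfolding paths_def by blast
qed

text \<open>For non-negative x this is the first point of the grid of mesh 1/(n + 1) strictly above
  x. Strictness matters because right-continuity speaks only of later times; the detour through
  \<open>nat\<close> indexes the values by the naturals.\<close>

definition right_approx :: "nat \<Rightarrow> real \<Rightarrow> real" where
  "right_approx n x = (real (nat \<lfloor>real (Suc n) * x\<rfloor>) + 1) / real (Suc n)"

lemma right_approx_bounds:
  assumes "0 \<le> x"
  shows "x < right_approx n x" "right_approx n x \<le> x + 1 / real (Suc n)"
proof -
  have "0 \<le> \<lfloor>real (Suc n) * x\<rfloor>" using assms by simp
  then have "real (nat \<lfloor>real (Suc n) * x\<rfloor>) = of_int \<lfloor>real (Suc n) * x\<rfloor>" by simp
  moreover define N where "N = real (Suc n)"
  moreover define k where "k = (of_int \<lfloor>N * x\<rfloor> :: real)"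
  ultimately have eq: "right_approx n x = (k + 1) / N" and N: "0 < N"
    by (simp_all add: right_approx_def)
  have "k \<le> N * x" "N * x < k + 1"
    unfolding k_def by linarith+
  then show "x < right_approx n x" "right_approx n x \<le> x + 1 / real (Suc n)"
    unfolding eq N_def[symmetric] using N by (simp_all add: field_simps)
qed

lemma right_approx_tendsto:
  assumes "0 \<le> x"
  shows "filterlim (\<lambda>n. right_approx n x) (at_right x) sequentially"
proof -
  have "(\<lambda>n. right_approx n x) \<longlonglongrightarrow> x"
  proof (rule tendsto_sandwich[OF _ _ tendsto_const])
    show "(\<lambda>n. x + 1 / real (Suc n)) \<longlonglongrightarrow> x"
      using LIMSEQ_inverse_real_of_nat_add[of x] by (simp only: inverse_eq_divide)
  qed (use right_approx_bounds[OF assms] in \<open>auto simp: less_imp_le\<close>)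
  then show ?thesis
    using right_approx_bounds(1)[OF assms] by (auto simp: filterlim_at intro!: always_eventually less_imp_neq[THEN not_sym])
qed

context right_process
begin

lemma space_P: "x \<in> topspace E \<Longrightarrow> space (P x) = paths E"
  using sets_eq_imp_space_eq[OF sets_P] by simp

text \<open>At the times \<open>right_approx n (\<tau> \<omega>)\<close> the path is measurable,
  because these take countably many values. The value at \<open>\<tau>\<close> is their limit by
  right-continuity, and in a topology that may be non-discrete this limit is recognized through a
  countable neighbourhood base at each state.\<close>

lemma path_at_random_time_measurable:
  assumes \<tau>: "\<tau> \<in> borel_measurable (path_algebra E)" and \<tau>0: "\<And>\<omega>. 0 \<le> \<tau> \<omega>"
  shows "{\<omega> \<in> paths E. \<omega> (\<tau> \<omega>) \<in> B} \<in> sets (path_algebra E)"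
proof -
  have approx: "{\<omega> \<in> paths E. \<omega> (right_approx n (\<tau> \<omega>)) \<in> B} \<in> sets (path_algebra E)" for n B
  proof -
    have "{\<omega> \<in> paths E. \<omega> (right_approx n (\<tau> \<omega>)) \<in> B} =
      (\<Union>j::nat. {\<omega> \<in> space (path_algebra E). nat \<lfloor>real (Suc n) * \<tau> \<omega>\<rfloor> = j} \<inter>
         {\<omega> \<in> paths E. \<omega> ((real j + 1) / real (Suc n)) \<in> B})"
      by (auto simp: right_approx_def)
    also have "\<dots> \<in> sets (path_algebra E)"
    proof (intro sets.countable_UN'' sets.Int coordinate_measurable)
      show "{\<omega> \<in> space (path_algebra E). nat \<lfloor>real (Suc n) * \<tau> \<omega>\<rfloor> = j} \<in> sets (path_algebra E)" for j
        using \<tau> by measurable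
    qed auto
    finally show ?thesis .
  qed
  have point: "{\<omega> \<in> paths E. \<omega> (\<tau> \<omega>) = Some z} \<in> sets (path_algebra E)" if z: "z \<in> topspace E" for z
  proof -
    obtain \<B> where \<B>: "countable \<B>" "\<And>V. V \<in> \<B> \<Longrightarrow> openin E V"
      "\<And>U. openin E U \<Longrightarrow> z \<in> U \<Longrightarrow> \<exists>V\<in>\<B>. z \<in> V \<and> V \<subseteq> U"
      using metrizable_imp_first_countable[OF metrizable] z unfolding first_countable_def by metis
    have "{\<omega> \<in> paths E. \<omega> (\<tau> \<omega>) = Some z} =
      {\<omega> \<in> space (path_algebra E). \<forall>V\<in>{V \<in> \<B>. z \<in> V}. \<exists>N. \<forall>n\<in>{N..}. \<omega> (right_approx n (\<tau> \<omega>)) \<in> Some ` V}"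
      unfolding space_path_algebra
    proof (intro Collect_cong conj_cong refl iffI ballI)
      fix \<omega> V assume \<omega>: "\<omega> \<in> paths E" "\<omega> (\<tau> \<omega>) = Some z" and V: "V \<in> {V \<in> \<B>. z \<in> V}"
      then have "\<forall>\<^sub>F s in at_right (\<tau> \<omega>). \<omega> s \<in> Some ` V"
        using path_right_continuous[OF \<omega>(1) \<tau>0 \<omega>(2)] \<B>(2) by simp
      then have "\<forall>\<^sub>F n in sequentially. \<omega> (right_approx n (\<tau> \<omega>)) \<in> Some ` V"
        using right_approx_tendsto[OF \<tau>0[of \<omega>]] unfolding filterlim_iff by auto
      then show "\<exists>N. \<forall>n\<in>{N..}. \<omega> (right_approx n (\<tau> \<omega>)) \<in> Some ` V"
        unfolding eventually_sequentially Ball_def atLeast_iff .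
    next
      fix \<omega> assume \<omega>: "\<omega> \<in> paths E"
        and *: "\<forall>V\<in>{V \<in> \<B>. z \<in> V}. \<exists>N. \<forall>n\<in>{N..}. \<omega> (right_approx n (\<tau> \<omega>)) \<in> Some ` V"
      have ev: "\<forall>\<^sub>F n in sequentially. \<omega> (right_approx n (\<tau> \<omega>)) \<in> Some ` U" if U: "openin E U" "z \<in> U" for U
      proof -
        obtain V where V: "V \<in> \<B>" "z \<in> V" "V \<subseteq> U" using \<B>(3)[OF U] by blast
        then have "V \<in> {V \<in> \<B>. z \<in> V}" by simp
        with * have "\<exists>N. \<forall>n\<in>{N..}. \<omega> (right_approx n (\<tau> \<omega>)) \<in> Some ` V" by (rule bspec)
        then have "\<forall>\<^sub>F n in sequentially. \<omega> (right_approx n (\<tau> \<omega>)) \<in> Some ` V"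
          unfolding eventually_sequentially Ball_def atLeast_iff .
        then show ?thesis
          by (rule eventually_mono) (use \<open>V \<subseteq> U\<close> in blast)
      qed
      show "\<omega> (\<tau> \<omega>) = Some z"
      proof (cases "\<omega> (\<tau> \<omega>)")
        \<comment> \<open>The cemetery cannot be such a limit: a dead path stays dead at all the
          later approximating times, whereas it is eventually in the state space.\<close>
        case None
        then have "\<omega> (right_approx n (\<tau> \<omega>)) = None" for n
          using path_dead[OF \<omega> \<tau>0[of \<omega>]] right_approx_bounds(1)[OF \<tau>0[of \<omega>], of n] by (simp add: less_imp_le)
        then have False using ev[OF openin_topspace z] by auto
        then show ?thesis ..
      next
        case (Some w)
        have w: "w \<in> topspace E" using path_values[OF \<omega> \<tau>0[of \<omega>]] Some by auto
        show ?thesis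
        proof (rule ccontr)
          assume "\<omega> (\<tau> \<omega>) \<noteq> Some z"
          then have "w \<noteq> z" using Some by simp
          then obtain U W where UW: "openin E U" "openin E W" "w \<in> U" "z \<in> W" "disjnt U W"
            using metrizable_imp_Hausdorff_space[OF metrizable] w z unfolding Hausdorff_space_def by metis
          have "\<forall>\<^sub>F s in at_right (\<tau> \<omega>). \<omega> s \<in> Some ` U"
            using path_right_continuous[OF \<omega> \<tau>0 Some UW(1,3)] .
          then have "\<forall>\<^sub>F n in sequentially. \<omega> (right_approx n (\<tau> \<omega>)) \<in> Some ` U"
            using right_approx_tendsto[OF \<tau>0[of \<omega>]] unfolding filterlim_iff by auto
          then have "\<forall>\<^sub>F n in sequentially. False"
            using ev[OF UW(2,4)] by eventually_elim (use UW(5) in \<open>auto simp: disjnt_def\<close>)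
          then show False by simp
        qed
      qed
    qed
    also have "\<dots> \<in> sets (path_algebra E)"
      by (intro sets.sets_Collect_countable_All' sets.sets_Collect_countable_Ex)
         (use \<B>(1) approx in \<open>auto intro: countable_subset\<close>)
    finally show ?thesis .
  qed
  \<comment> \<open>Countably many states reduce every B to the point events, and the cemetery is
    what remains.\<close>
  let ?A = "\<lambda>C. \<Union>z\<in>C. {\<omega> \<in> paths E. \<omega> (\<tau> \<omega>) = Some z}"
  have A: "?A C \<in> sets (path_algebra E)" if "C \<subseteq> topspace E" for C
    using that countable_states by (intro sets.countable_UN'' point) (auto intro: countable_subset)
  have range: "\<omega> (\<tau> \<omega>) \<in> insert None (Some ` topspace E)" if "\<omega> \<in> paths E" for \<omega>
    using path_values[OF that \<tau>0] .
  have "{\<omega> \<in> paths E. \<omega> (\<tau> \<omega>) \<in> B} =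
      ?A (topspace E \<inter> Some -` B) \<union> (if None \<in> B then space (path_algebra E) - ?A (topspace E) else {})"
  proof (rule Set.set_eqI)
    fix \<omega>
    show "\<omega> \<in> {\<omega> \<in> paths E. \<omega> (\<tau> \<omega>) \<in> B} \<longleftrightarrow>
      \<omega> \<in> ?A (topspace E \<inter> Some -` B) \<union> (if None \<in> B then space (path_algebra E) - ?A (topspace E) else {})"
      using range[of \<omega>] by (cases "\<omega> (\<tau> \<omega>)") auto
  qed
  also have "\<dots> \<in> sets (path_algebra E)"
    using A[of "topspace E \<inter> Some -` B"] A[of "topspace E"]
    by (cases "None \<in> B") (simp_all only: if_True if_False sets.Un sets.Diff sets.top Un_empty_right Int_lower1 subset_refl)
  finally show ?thesis .
qed

lemma shift_measurable:
  assumes \<tau>: "\<tau> \<in> borel_measurable (path_algebra E)" and \<tau>0: "\<And>\<omega>. 0 \<le> \<tau> \<omega>"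
  shows "(\<lambda>\<omega>. shift (\<tau> \<omega>) \<omega>) \<in> measurable (path_algebra E) (path_algebra E)"
proof -
  have "(\<lambda>\<omega>. shift (\<tau> \<omega>) \<omega>) \<in> measurable (path_algebra E)
     (sigma (paths E) {{\<omega> \<in> paths E. \<omega> s \<in> B} | s B. 0 \<le> s})"
  proof (rule measurable_measure_of)
    fix A :: "'a path set" assume "A \<in> {{\<omega> \<in> paths E. \<omega> s \<in> B} | s B. 0 \<le> s}"
    then obtain s B where A: "A = {\<omega> \<in> paths E. \<omega> s \<in> B}" "0 \<le> s" by blast
    have "(\<lambda>\<omega>. shift (\<tau> \<omega>) \<omega>) -` A \<inter> space (path_algebra E) = {\<omega> \<in> paths E. \<omega> (\<tau> \<omega> + s) \<in> B}"
      using A \<tau>0 shift_in_paths[OF _ \<tau>0] by (auto simp: shift_def)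
    also have "\<dots> \<in> sets (path_algebra E)"
      using \<tau> \<tau>0 \<open>0 \<le> s\<close> by (intro path_at_random_time_measurable) auto
    finally show "(\<lambda>\<omega>. shift (\<tau> \<omega>) \<omega>) -` A \<inter> space (path_algebra E) \<in> sets (path_algebra E)" .
  qed (use \<tau>0 in \<open>auto simp: shift_in_paths\<close>)
  then show ?thesis by (simp add: path_algebra_def)
qed

section \<open>The strong Markov property with a prescribed landing state\<close>

definition stopped_at :: "('a path \<Rightarrow> ennreal) \<Rightarrow> 'a \<Rightarrow> 'a path set" where
  "stopped_at S z = {\<omega> \<in> paths E. S \<omega> < \<infinity> \<and> \<omega> (enn2real (S \<omega>)) = Some z}"

abbreviation shift_at :: "('a path \<Rightarrow> ennreal) \<Rightarrow> 'a path \<Rightarrow> 'a path" where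
  "shift_at S \<omega> \<equiv> shift (enn2real (S \<omega>)) \<omega>"

lemma stopping_time_measurable:
  "stopping_time (history_plus E) S \<Longrightarrow> S \<in> borel_measurable (path_algebra E)"
  by (rule measurable_stopping_time[OF _ history_plus_path_algebra]) auto

lemma stopped_at_measurable:
  assumes "stopping_time (history_plus E) S"
  shows "stopped_at S z \<in> sets (path_algebra E)"
proof -
  have S: "S \<in> borel_measurable (path_algebra E)"
    using stopping_time_measurable[OF assms] .
  have "stopped_at S z = {\<omega> \<in> space (path_algebra E). S \<omega> < \<infinity>} \<inter> {\<omega> \<in> paths E. \<omega> (enn2real (S \<omega>)) \<in> {Some z}}"
    by (auto simp: stopped_at_def)
  also have "\<dots> \<in> sets (path_algebra E)"
  proof (intro sets.Int path_at_random_time_measurable)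
    show "{\<omega> \<in> space (path_algebra E). S \<omega> < \<infinity>} \<in> sets (path_algebra E)"
      "(\<lambda>\<omega>. enn2real (S \<omega>)) \<in> borel_measurable (path_algebra E)"
      using S by measurable
  qed simp
  finally show ?thesis .
qed

lemma shift_at_measurable:
  assumes "stopping_time (history_plus E) S"
  shows "shift_at S \<in> measurable (path_algebra E) (path_algebra E)"
  using stopping_time_measurable[OF assms] by (intro shift_measurable) auto

text \<open>Putting the constraint on the starting point into B makes the integrand of
  \<open>strong_markov\<close> vanish unless the process sits at z.\<close>

lemma emeasure_start:
  assumes w: "w \<in> topspace E" and B: "B \<in> sets (path_algebra E)"
  shows "emeasure (P w) {\<omega> \<in> B. \<omega> 0 = Some z} = (if w = z then emeasure (P w) B else 0)"
proof -
  have "{\<omega> \<in> B. \<omega> 0 = Some z} = B \<inter> {\<omega> \<in> paths E. \<omega> 0 \<in> {Some z}}"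
    using sets.sets_into_space[OF B] by auto
  then have meas: "{\<omega> \<in> B. \<omega> 0 = Some z} \<in> sets (P w)"
    unfolding sets_P[OF w] using B coordinate_measurable[of 0 E "{Some z}"] by (simp only: sets.Int)
  show ?thesis
  proof (cases "w = z")
    case True
    then have "AE \<omega> in P w. \<omega> \<in> {\<omega> \<in> B. \<omega> 0 = Some z} \<longleftrightarrow> \<omega> \<in> B"
      using start[OF w] by auto
    then have "emeasure (P w) {\<omega> \<in> B. \<omega> 0 = Some z} = emeasure (P w) B"
      using B meas by (intro emeasure_eq_AE) (auto simp: sets_P[OF w])
    then show ?thesis using True by simp
  next
    case False
    then have "AE \<omega> in P w. \<omega> \<notin> {\<omega> \<in> B. \<omega> 0 = Some z}"
      using start[OF w] by auto
    then show ?thesis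
      using False AE_iff_null_sets[OF meas] by (simp add: null_setsD1)
  qed
qed

text \<open>The landing state is selected on the side of the future, by intersecting B with
  {\<open>\<omega> 0 = Some z\<close>}, so \<open>strong_markov\<close> can be applied with A the
  whole path space.\<close>

lemma strong_markov_at_point:
  assumes x: "x \<in> topspace E" and z: "z \<in> topspace E"
    and S: "stopping_time (history_plus E) S" and B: "B \<in> sets (path_algebra E)"
  shows "emeasure (P x) {\<omega> \<in> stopped_at S z. shift_at S \<omega> \<in> B} =
    emeasure (P x) (stopped_at S z) * emeasure (P z) B"
proof -
  let ?B = "{\<omega> \<in> B. \<omega> 0 = Some z}"
  have "?B = B \<inter> {\<omega> \<in> paths E. \<omega> 0 \<in> {Some z}}"
    using sets.sets_into_space[OF B] by auto
  then have B': "?B \<in> sets (path_algebra E)"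
    using B coordinate_measurable[of 0 E "{Some z}"] by (simp only: sets.Int)
  have "paths E \<in> sets (filtration.pre_sigma (paths E) (history_plus E) S)"
    using stopping_timeD[OF S]
    by (intro filtration.sets_pre_sigmaI[OF filtration_history_plus S]) (simp add: Measurable.pred_def)
  note strong_markov[OF x S this B']
  moreover have "{\<omega> \<in> paths E. S \<omega> < \<infinity> \<and> \<omega> (enn2real (S \<omega>)) \<noteq> None \<and> shift_at S \<omega> \<in> ?B} =
      {\<omega> \<in> stopped_at S z. shift_at S \<omega> \<in> B}"
    by (auto simp: stopped_at_def shift_def)
  moreover have "(\<integral>\<^sup>+\<omega>\<in>{\<omega> \<in> paths E. S \<omega> < \<infinity> \<and> \<omega> (enn2real (S \<omega>)) \<noteq> None}.
            emeasure (P (the (\<omega> (enn2real (S \<omega>))))) ?B \<partial>P x) =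
      (\<integral>\<^sup>+\<omega>. emeasure (P z) B * indicator (stopped_at S z) \<omega> \<partial>P x)"
  proof (rule nn_integral_cong)
    fix \<omega> assume "\<omega> \<in> space (P x)"
    then have \<omega>: "\<omega> \<in> paths E" using space_P[OF x] by simp
    then have "\<omega> (enn2real (S \<omega>)) \<in> insert None (Some ` topspace E)"
      by (rule path_values) simp
    then show "emeasure (P (the (\<omega> (enn2real (S \<omega>))))) ?B *
        indicator {\<omega> \<in> paths E. S \<omega> < \<infinity> \<and> \<omega> (enn2real (S \<omega>)) \<noteq> None} \<omega> =
        emeasure (P z) B * indicator (stopped_at S z) \<omega>"
      using \<omega> emeasure_start[OF _ B] by (auto simp: stopped_at_def indicator_def)
  qed
  ultimately show ?thesis
    using stopped_at_measurable[OF S] sets_P[OF x] by (simp add: nn_integral_cmult_indicator mult.commute)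
qed

lemma distr_shift_at:
  assumes x: "x \<in> topspace E" and z: "z \<in> topspace E" and S: "stopping_time (history_plus E) S"
  shows "distr (density (P x) (indicator (stopped_at S z))) (path_algebra E) (shift_at S) =
    scale_measure (emeasure (P x) (stopped_at S z)) (P z)"
proof (rule measure_eqI)
  fix A assume "A \<in> sets (distr (density (P x) (indicator (stopped_at S z))) (path_algebra E) (shift_at S))"
  then have A: "A \<in> sets (path_algebra E)" by simp
  have th: "shift_at S \<in> measurable (P x) (path_algebra E)"
    using shift_at_measurable[OF S] measurable_cong_sets[OF sets_P[OF x] refl] by blast
  have Hs: "stopped_at S z \<in> sets (P x)" using stopped_at_measurable[OF S] sets_P[OF x] by simp
  have sub: "shift_at S -` A \<inter> space (P x) \<in> sets (P x)" by (rule measurable_sets[OF th A])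
  have "emeasure (distr (density (P x) (indicator (stopped_at S z))) (path_algebra E) (shift_at S)) A =
      (\<integral>\<^sup>+\<omega>. indicator (stopped_at S z) \<omega> * indicator (shift_at S -` A \<inter> space (P x)) \<omega> \<partial>P x)"
    using th A Hs sub by (subst emeasure_distr) (auto simp: emeasure_density)
  also have "\<dots> = emeasure (P x) (stopped_at S z \<inter> (shift_at S -` A \<inter> space (P x)))"
    using Hs sub by (simp flip: indicator_inter_arith)
  also have "stopped_at S z \<inter> (shift_at S -` A \<inter> space (P x)) = {\<omega> \<in> stopped_at S z. shift_at S \<omega> \<in> A}"
    using sets.sets_into_space[OF Hs] by auto
  finally show "emeasure (distr (density (P x) (indicator (stopped_at S z))) (path_algebra E) (shift_at S)) A =
      emeasure (scale_measure (emeasure (P x) (stopped_at S z)) (P z)) A"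
    using strong_markov_at_point[OF x z S A] by simp
qed (simp add: sets_P[OF z])

lemma nn_integral_shift_at:
  assumes x: "x \<in> topspace E" and z: "z \<in> topspace E" and S: "stopping_time (history_plus E) S"
    and f: "f \<in> borel_measurable (path_algebra E)"
  shows "(\<integral>\<^sup>+\<omega>. indicator (stopped_at S z) \<omega> * f (shift_at S \<omega>) \<partial>P x) =
    emeasure (P x) (stopped_at S z) * (\<integral>\<^sup>+\<omega>. f \<omega> \<partial>P z)"
proof -
  have th: "shift_at S \<in> measurable (P x) (path_algebra E)"
    using shift_at_measurable[OF S] measurable_cong_sets[OF sets_P[OF x] refl] by blast
  have Hs: "stopped_at S z \<in> sets (P x)" using stopped_at_measurable[OF S] sets_P[OF x] by simp
  have "(\<integral>\<^sup>+\<omega>. indicator (stopped_at S z) \<omega> * f (shift_at S \<omega>) \<partial>P x) =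
      (\<integral>\<^sup>+\<omega>. f (shift_at S \<omega>) \<partial>density (P x) (indicator (stopped_at S z)))"
    using th Hs f by (subst nn_integral_density) (auto intro: measurable_compose)
  also have "\<dots> = (\<integral>\<^sup>+\<omega>. f \<omega> \<partial>distr (density (P x) (indicator (stopped_at S z))) (path_algebra E) (shift_at S))"
    using th f by (subst nn_integral_distr) auto
  also have "\<dots> = emeasure (P x) (stopped_at S z) * (\<integral>\<^sup>+\<omega>. f \<omega> \<partial>P z)"
    unfolding distr_shift_at[OF x z S]
    using f measurable_cong_sets[OF sets_P[OF z] refl] by (subst nn_integral_scale_measure) auto
  finally show ?thesis .
qed

text \<open>Meant for properties of local times, whose exceptional sets are not known to be
  measurable; a measurable null superset N is pulled back in their place.\<close>

lemma AE_shift_at: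
  assumes x: "x \<in> topspace E" and z: "z \<in> topspace E" and S: "stopping_time (history_plus E) S"
    and Q: "AE \<omega> in P z. Q \<omega>"
  shows "AE \<omega> in P x. \<omega> \<in> stopped_at S z \<longrightarrow> Q (shift_at S \<omega>)"
proof -
  obtain N where N: "{\<omega> \<in> space (P z). \<not> Q \<omega>} \<subseteq> N" "emeasure (P z) N = 0" "N \<in> sets (P z)"
    using Q by (rule AE_E)
  let ?N = "{\<omega> \<in> stopped_at S z. shift_at S \<omega> \<in> N}"
  have "?N = stopped_at S z \<inter> (shift_at S -` N \<inter> space (path_algebra E))"
    by (auto simp: stopped_at_def)
  then have N': "?N \<in> sets (P x)"
    using stopped_at_measurable[OF S] measurable_sets[OF shift_at_measurable[OF S], of N] N(3)
    by (simp add: sets_P[OF x] sets_P[OF z])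
  have "emeasure (P x) ?N = 0"
    using strong_markov_at_point[OF x z S, of N] N by (simp add: sets_P[OF z])
  then show ?thesis
    using N' N(1)
    by (intro AE_I[of _ _ ?N]) (auto simp: stopped_at_def space_P[OF x] space_P[OF z] shift_in_paths)
qed

end

subsection \<open>Hitting times and the inverse of the potential matrix\<close>

text \<open>The path-by-path half of \<open>continuous_additive_functional\<close>, collected so
  that it can be used as a single almost sure property.\<close>

definition additive_path :: "(real \<Rightarrow> 'a path \<Rightarrow> real) \<Rightarrow> 'a path \<Rightarrow> bool" where
  "additive_path L \<omega> \<longleftrightarrow> L 0 \<omega> = 0 \<and> continuous_on {0..} (\<lambda>t. L t \<omega>) \<and> mono_on {0..} (\<lambda>t. L t \<omega>) \<and>
     (\<forall>s t. 0 \<le> s \<and> s \<le> t \<and> \<omega> s = None \<longrightarrow> L t \<omega> = L s \<omega>) \<and>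
     (\<forall>s t. 0 \<le> s \<and> 0 \<le> t \<longrightarrow> L (t + s) \<omega> = L t \<omega> + L s (shift t \<omega>))"

definition total_local_time :: "(real \<Rightarrow> 'a path \<Rightarrow> real) \<Rightarrow> 'a path \<Rightarrow> ennreal" where
  "total_local_time L \<omega> = (SUP t\<in>{0..}. ennreal (L t \<omega>))"

lemma additive_path_mono: "additive_path L \<omega> \<Longrightarrow> 0 \<le> s \<Longrightarrow> s \<le> t \<Longrightarrow> L s \<omega> \<le> L t \<omega>"
  by (auto simp: additive_path_def mono_on_def)

lemma additive_path_nonneg: "additive_path L \<omega> \<Longrightarrow> 0 \<le> t \<Longrightarrow> 0 \<le> L t \<omega>"
  using additive_path_mono[of L \<omega> 0 t] by (simp add: additive_path_def)

lemma additive_path_dead: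
  "additive_path L \<omega> \<Longrightarrow> 0 \<le> s \<Longrightarrow> s \<le> t \<Longrightarrow> \<omega> s = None \<Longrightarrow> L t \<omega> = L s \<omega>"
  unfolding additive_path_def by blast

lemma total_local_time_split:
  assumes L: "additive_path L \<omega>" and t: "0 \<le> t"
  shows "total_local_time L \<omega> = ennreal (L t \<omega>) + total_local_time L (shift t \<omega>)"
proof -
  have add: "ennreal (L (t + s) \<omega>) = ennreal (L t \<omega>) + ennreal (L s (shift t \<omega>))" if "0 \<le> s" for s
  proof -
    have "L (t + s) \<omega> = L t \<omega> + L s (shift t \<omega>)" using L t that by (simp add: additive_path_def)
    moreover have "L t \<omega> \<le> L (t + s) \<omega>" using additive_path_mono[OF L t] that by simp
    ultimately show ?thesis using additive_path_nonneg[OF L t] by simp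
  qed
  have "total_local_time L \<omega> = (SUP s\<in>{0..}. ennreal (L (t + s) \<omega>))"
    unfolding total_local_time_def
  proof (intro antisym SUP_least)
    fix s :: real assume "s \<in> {0..}"
    then show "ennreal (L s \<omega>) \<le> (SUP s\<in>{0..}. ennreal (L (t + s) \<omega>))"
      using t by (intro SUP_upper2[of s] ennreal_leI additive_path_mono[OF L]) auto
  next
    fix s :: real assume "s \<in> {0..}"
    then show "ennreal (L (t + s) \<omega>) \<le> (SUP s\<in>{0..}. ennreal (L s \<omega>))"
      using t by (intro SUP_upper) auto
  qed
  also have "\<dots> = (SUP s\<in>{0..}. ennreal (L t \<omega>) + ennreal (L s (shift t \<omega>)))"
    using add by (intro SUP_cong) auto
  also have "\<dots> = ennreal (L t \<omega>) + total_local_time L (shift t \<omega>)"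
    unfolding total_local_time_def by (subst ennreal_SUP_add_right) auto
  finally show ?thesis .
qed

text \<open>Monotonicity turns the supremum over all times into a countable one; this gives the
  total local time a measurable version.\<close>

lemma total_local_time_nat:
  assumes L: "additive_path L \<omega>"
  shows "total_local_time L \<omega> = (SUP n::nat. ennreal (L (real n) \<omega>))"
  unfolding total_local_time_def
proof (intro antisym SUP_least)
  fix t :: real assume t: "t \<in> {0..}"
  obtain n :: nat where "t \<le> real n" using real_arch_simple by blast
  then show "ennreal (L t \<omega>) \<le> (SUP n::nat. ennreal (L (real n) \<omega>))"
    using t by (intro SUP_upper2[of n] ennreal_leI additive_path_mono[OF L]) auto
next
  fix n :: nat
  show "ennreal (L (real n) \<omega>) \<le> (SUP t\<in>{0..}. ennreal (L t \<omega>))"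
    by (rule SUP_upper) simp
qed

text \<open>Left-continuity carries the value 0 up to the hitting time itself, not just to all
  earlier times.\<close>

lemma additive_path_left_zero:
  assumes L: "additive_path L \<omega>" and t: "0 \<le> t" and z: "\<And>s. 0 \<le> s \<Longrightarrow> s < t \<Longrightarrow> L s \<omega> = 0"
  shows "L t \<omega> = 0"
proof (cases "t = 0")
  case True
  then show ?thesis using L by (simp add: additive_path_def)
next
  case False
  then have t: "0 < t" using t by simp
  have "((\<lambda>s. L s \<omega>) \<longlongrightarrow> L t \<omega>) (at t within {0..})"
    using L t by (auto simp: additive_path_def continuous_on_def)
  then have "((\<lambda>s. L s \<omega>) \<longlongrightarrow> L t \<omega>) (at t within {0..<t})"
    by (rule tendsto_within_subset) auto
  moreover have "((\<lambda>s. L s \<omega>) \<longlongrightarrow> 0) (at t within {0..<t})"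
    using z by (intro tendsto_eventually) (auto simp: eventually_at_filter)
  moreover have "at t within {0..<t} \<noteq> bot"
    using t by (simp add: at_within_eq_bot_iff trivial_limit_within islimpt_greaterThanLessThan2)
  ultimately show ?thesis using tendsto_unique by blast
qed

context right_process
begin

lemma local_time_AE:
  assumes "local_time_at E P y L" "x \<in> topspace E"
  shows "AE \<omega> in P x. additive_path L \<omega>"
  using assms unfolding local_time_at_def continuous_additive_functional_def additive_path_def by blast

lemma local_time_on: "local_time_at E P y L \<Longrightarrow> AE \<omega> in P y. \<forall>t>0. 0 < L t \<omega>"
  unfolding local_time_at_def by (elim conjE)

lemma local_time_off:
  "local_time_at E P y L \<Longrightarrow> x \<in> topspace E \<Longrightarrow> x \<noteq> y \<Longrightarrow> AE \<omega> in P x. \<exists>t>0. L t \<omega> = 0"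
  unfolding local_time_at_def by (elim conjE) simp

text \<open>The version g depends on the starting point x, since adaptedness holds up to
  \<open>P x\<close>-null sets. This is why \<open>hitting_time\<close> and \<open>renewal\<close>
  fix x.\<close>

lemma local_time_version:
  assumes L: "local_time_at E P y L" and x: "x \<in> topspace E"
  obtains g where "\<And>t. 0 \<le> t \<Longrightarrow> g t \<in> borel_measurable (history_plus E (ennreal t))"
    "\<And>t. 0 \<le> t \<Longrightarrow> AE \<omega> in P x. L t \<omega> = g t \<omega>"
proof -
  have "\<forall>t. \<exists>g. 0 \<le> t \<longrightarrow> g \<in> borel_measurable (history_plus E (ennreal t)) \<and> (AE \<omega> in P x. L t \<omega> = g \<omega>)"
    using assms unfolding local_time_at_def continuous_additive_functional_def by blast
  then show ?thesis using that by metis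
qed

lemma total_local_time_version:
  assumes L: "local_time_at E P y L" and x: "x \<in> topspace E"
  obtains F where "F \<in> borel_measurable (path_algebra E)" "AE \<omega> in P x. total_local_time L \<omega> = F \<omega>"
proof -
  obtain g where g: "\<And>t. 0 \<le> t \<Longrightarrow> g t \<in> borel_measurable (history_plus E (ennreal t))"
    "\<And>t. 0 \<le> t \<Longrightarrow> AE \<omega> in P x. L t \<omega> = g t \<omega>"
    using local_time_version[OF L x] by blast
  have [measurable]: "g (real n) \<in> borel_measurable (path_algebra E)" for n
    using g(1)[of "real n"] by (rule measurable_history_plus_path_algebra) simp
  have "AE \<omega> in P x. \<forall>n::nat. L (real n) \<omega> = g (real n) \<omega>"
    using g(2) by (simp add: AE_all_countable)
  with local_time_AE[OF L x] have "AE \<omega> in P x. total_local_time L \<omega> = (SUP n::nat. ennreal (g (real n) \<omega>))"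
    by eventually_elim (simp add: total_local_time_nat)
  moreover have "(\<lambda>\<omega>. SUP n::nat. ennreal (g (real n) \<omega>)) \<in> borel_measurable (path_algebra E)"
    by measurable
  ultimately show ?thesis using that by blast
qed

text \<open>Hitting times are read off from the local times, which are adapted and continuous, so that no
  debut theorem is needed. That the path really sits in \<open>B\<close> at this time follows
  from the strong Markov property, since a local time at \<open>y\<close> does not grow immediately from any
  other state.\<close>

lemma hitting_time:
  assumes x: "x \<in> topspace E" and B: "finite B" "B \<subseteq> topspace E" "x \<notin> B"
    and L: "\<And>y. y \<in> B \<Longrightarrow> local_time_at E P y (L y)"
  obtains S where "stopping_time (history_plus E) S"
    "AE \<omega> in P x. 0 < S \<omega>"
    "AE \<omega> in P x. S \<omega> < \<infinity> \<longrightarrow> (\<exists>z\<in>B. \<omega> \<in> stopped_at S z)"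
    "AE \<omega> in P x. \<forall>y\<in>B. \<forall>t\<ge>0. ennreal t \<le> S \<omega> \<longrightarrow> L y t \<omega> = 0"
proof -
  have "\<forall>y\<in>B. \<exists>g. \<forall>t\<ge>0. g t \<in> borel_measurable (history_plus E (ennreal t)) \<and> (AE \<omega> in P x. L y t \<omega> = g t \<omega>)"
    using local_time_version[OF L x] by metis
  then obtain g where
    g: "\<And>y t. y \<in> B \<Longrightarrow> 0 \<le> t \<Longrightarrow> g y t \<in> borel_measurable (history_plus E (ennreal t))"
    and Lg: "\<And>y t. y \<in> B \<Longrightarrow> 0 \<le> t \<Longrightarrow> AE \<omega> in P x. L y t \<omega> = g y t \<omega>"
    by metis
  \<comment> \<open>The versions g replace the local times because
    \<open>stopping_time_debut\<close> asks for genuine membership in the filtration;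
    \<open>ver\<close> identifies the two almost surely at all rational times.\<close>
  define D where "D q = (\<Union>y\<in>B. {\<omega> \<in> space (history_plus E (ennreal q)). 0 < g y q \<omega>})" for q
  define S where "S = debut D"
  have S: "stopping_time (history_plus E) S"
    unfolding S_def
  proof (rule stopping_time_debut)
    fix q :: real assume "q \<in> \<rat>" "0 \<le> q"
    have "{\<omega> \<in> space (history_plus E (ennreal q)). 0 < g y q \<omega>} \<in> sets (history_plus E (ennreal q))" if "y \<in> B" for y
      using g[OF that \<open>0 \<le> q\<close>] by measurable
    then show "D q \<in> sets (history_plus E (ennreal q))"
      unfolding D_def using B(1) by (intro sets.finite_UN) auto
  qed
  have ver: "AE \<omega> in P x. \<forall>q\<in>{q \<in> \<rat>. 0 \<le> q}. \<forall>y\<in>B. L y q \<omega> = g y q \<omega>"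
  proof -
    have "countable {q :: real. q \<in> \<rat> \<and> 0 \<le> q}"
      by (rule countable_subset[OF _ countable_rat]) auto
    moreover have "AE \<omega> in P x. \<forall>y\<in>B. L y q \<omega> = g y q \<omega>" if "0 \<le> q" for q
      using Lg[OF _ that] B(1) by (simp add: AE_ball_countable countable_finite)
    ultimately show ?thesis
      by (subst AE_ball_countable) simp_all
  qed
  have reg: "AE \<omega> in P x. \<forall>y\<in>B. additive_path (L y) \<omega>"
    using local_time_AE[OF L x] B(1) by (simp add: AE_ball_countable countable_finite)
  have zero: "AE \<omega> in P x. \<forall>y\<in>B. \<exists>t>0. L y t \<omega> = 0"
  proof -
    have "AE \<omega> in P x. \<exists>t>0. L y t \<omega> = 0" if "y \<in> B" for y
      using local_time_off[OF L[OF that] x] B(3) that by blast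
    then show ?thesis using B(1) by (simp add: AE_ball_countable countable_finite)
  qed
  have paths: "AE \<omega> in P x. \<omega> \<in> paths E"
    by (rule AE_I2) (simp add: space_P[OF x])
  have D: "\<omega> \<in> D q \<longleftrightarrow> (\<exists>y\<in>B. 0 < L y q \<omega>)"
    if "\<omega> \<in> paths E" "\<forall>q\<in>{q \<in> \<rat>. 0 \<le> q}. \<forall>y\<in>B. L y q \<omega> = g y q \<omega>" "q \<in> \<rat>" "0 \<le> q" for q \<omega>
    using that by (auto simp: D_def)
  have before: "AE \<omega> in P x. \<forall>y\<in>B. \<forall>t\<ge>0. ennreal t \<le> S \<omega> \<longrightarrow> L y t \<omega> = 0"
    using ver reg paths
  proof eventually_elim
    case (elim \<omega>)
    show ?case
    proof (intro ballI allI impI)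
      fix y t assume y: "y \<in> B" and t: "0 \<le> t" "ennreal t \<le> S \<omega>"
      have Ly: "additive_path (L y) \<omega>" using elim y by blast
      show "L y t \<omega> = 0"
      proof (rule additive_path_left_zero[OF Ly t(1)])
        fix s assume s: "0 \<le> s" "s < t"
        then obtain q where q: "q \<in> \<rat>" "s < q" "q < t" using Rats_dense_in_real by blast
        have "\<not> 0 < L y q \<omega>"
        proof
          assume "0 < L y q \<omega>"
          then have "\<omega> \<in> D q" using D[OF elim(3,1) q(1)] s q y by auto
          then have "S \<omega> \<le> ennreal q"
            unfolding S_def debut_def using s q by (intro Inf_lower) auto
          then have "ennreal t \<le> ennreal q" using t(2) by (rule order.trans[rotated])
          then show False using q s by (simp add: ennreal_le_iff2)
        qed
        moreover have "0 \<le> L y s \<omega>" "L y s \<omega> \<le> L y q \<omega>"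
          using additive_path_nonneg[OF Ly] additive_path_mono[OF Ly] s q by auto
        ultimately show "L y s \<omega> = 0" by simp
      qed
    qed
  qed
  have pos: "AE \<omega> in P x. 0 < S \<omega>"
    using ver reg paths zero
  proof eventually_elim
    case (elim \<omega>)
    then obtain r where r: "\<And>y. y \<in> B \<Longrightarrow> 0 < r y \<and> L y (r y) \<omega> = 0" by metis
    \<comment> \<open>The inserted 1 keeps the minimum meaningful when B is empty.\<close>
    define t where "t = Min (insert 1 (r ` B))"
    have t: "0 < t" "\<And>y. y \<in> B \<Longrightarrow> t \<le> r y"
      unfolding t_def using B(1) r by auto
    have "ennreal t \<le> S \<omega>"
      unfolding S_def debut_def
    proof (rule Inf_greatest, clarify)
      fix q assume q: "q \<in> \<rat>" "0 \<le> q" "\<omega> \<in> D q"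
      then obtain y where y: "y \<in> B" "0 < L y q \<omega>" using D[OF elim(3,1) q(1,2)] by auto
      show "ennreal t \<le> ennreal q"
      proof (rule ennreal_leI, rule ccontr)
        assume "\<not> t \<le> q"
        then have "L y q \<omega> \<le> L y (r y) \<omega>"
          using additive_path_mono[of "L y" \<omega> q "r y"] elim(2) y(1) q(2) t(2)[OF y(1)] by auto
        then show False using y r by auto
      qed
    qed
    then show ?case using t(1) by (auto intro: less_le_trans[of _ "ennreal t"])
  qed
  \<comment> \<open>Right after S some local time is positive, but the site could vary as the times
    decrease to S. As B is finite, one site y works for all of them.\<close>
  have after: "\<exists>y\<in>B. \<forall>s>0. 0 < L y (enn2real (S \<omega>) + s) \<omega>"
    if \<omega>: "\<omega> \<in> paths E" "\<forall>q\<in>{q \<in> \<rat>. 0 \<le> q}. \<forall>y\<in>B. L y q \<omega> = g y q \<omega>"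
      "\<forall>y\<in>B. additive_path (L y) \<omega>" and fin: "S \<omega> < \<infinity>" for \<omega>
  proof (rule ccontr)
    define \<tau> where "\<tau> = enn2real (S \<omega>)"
    have \<tau>: "0 \<le> \<tau>" "S \<omega> = ennreal \<tau>" using fin by (auto simp: \<tau>_def less_top)
    assume "\<not> ?thesis"
    then have "\<forall>y\<in>B. \<exists>s>0. \<not> 0 < L y (\<tau> + s) \<omega>" by (simp add: \<tau>_def)
    then obtain r where r: "\<And>y. y \<in> B \<Longrightarrow> 0 < r y \<and> \<not> 0 < L y (\<tau> + r y) \<omega>" by metis
    define s where "s = Min (insert 1 (r ` B))"
    have s: "0 < s" "\<And>y. y \<in> B \<Longrightarrow> s \<le> r y"
      unfolding s_def using B(1) r by auto
    have "S \<omega> < ennreal (\<tau> + s)" using \<tau> s(1) by (simp add: ennreal_less_iff)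
    then obtain q where q: "q \<in> \<rat>" "0 \<le> q" "\<omega> \<in> D q" "ennreal q < ennreal (\<tau> + s)"
      unfolding S_def debut_def Inf_less_iff by blast
    then obtain y where y: "y \<in> B" "0 < L y q \<omega>" using D[OF \<omega>(1,2) q(1,2)] by auto
    have "q < \<tau> + s" using q(2,4) by (simp add: ennreal_less_iff)
    then have "L y q \<omega> \<le> L y (\<tau> + r y) \<omega>"
      using additive_path_mono[of "L y" \<omega> q "\<tau> + r y"] \<omega>(3) y(1) q(2) s(2)[OF y(1)] by auto
    then show False using y r[OF y(1)] by simp
  qed
  \<comment> \<open>From a landing state w, the local time of any other site stays 0 for a while.
    Countability of the states makes this hold for all w simultaneously.\<close>
  have other: "AE \<omega> in P x. \<forall>w\<in>topspace E. \<forall>y\<in>B. w \<noteq> y \<longrightarrow> \<omega> \<in> stopped_at S w \<longrightarrow>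
      (\<exists>t>0. L y t (shift_at S \<omega>) = 0)"
  proof -
    have "AE \<omega> in P x. w \<noteq> y \<longrightarrow> \<omega> \<in> stopped_at S w \<longrightarrow> (\<exists>t>0. L y t (shift_at S \<omega>) = 0)"
      if "w \<in> topspace E" "y \<in> B" for w y
    proof (cases "w = y")
      case False
      then have "AE \<omega> in P w. \<exists>t>0. L y t \<omega> = 0"
        using local_time_off[OF L[OF that(2)] that(1)] by simp
      from AE_shift_at[OF x that(1) S this] show ?thesis by simp
    qed simp
    then show ?thesis
      using B(1) countable_states by (simp add: AE_ball_countable countable_finite)
  qed
  have at: "AE \<omega> in P x. S \<omega> < \<infinity> \<longrightarrow> (\<exists>z\<in>B. \<omega> \<in> stopped_at S z)"
    using ver reg paths before other
  proof eventually_elim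
    case (elim \<omega>)
    show ?case
    proof
      assume fin: "S \<omega> < \<infinity>"
      define \<tau> where "\<tau> = enn2real (S \<omega>)"
      have \<tau>: "0 \<le> \<tau>" "ennreal \<tau> = S \<omega>" using fin by (auto simp: \<tau>_def less_top)
      obtain y where y: "y \<in> B" "\<And>s. 0 < s \<Longrightarrow> 0 < L y (\<tau> + s) \<omega>"
        using after[OF elim(3,1,2) fin] unfolding \<tau>_def by blast
      have L\<tau>: "L y \<tau> \<omega> = 0" using elim(4) y(1) \<tau> by simp
      have Ly: "additive_path (L y) \<omega>" using elim(2) y(1) by blast
      have "0 < L y s (shift \<tau> \<omega>)" if "0 < s" for s
        using y(2)[OF that] Ly L\<tau> \<tau>(1) that by (simp add: additive_path_def)
      \<comment> \<open>A local time stops growing at the lifetime, but this one grows after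
        \<open>\<tau>\<close>.\<close>
      moreover have "\<omega> \<tau> \<noteq> None"
      proof
        assume "\<omega> \<tau> = None"
        then have "L y (\<tau> + 1) \<omega> = L y \<tau> \<omega>" using additive_path_dead[OF Ly \<tau>(1), of "\<tau> + 1"] by simp
        then show False using y(2)[of 1] L\<tau> by simp
      qed
      then obtain w where w: "\<omega> \<tau> = Some w" by blast
      then have "w \<in> topspace E" using path_values[OF elim(3) \<tau>(1)] by auto
      moreover have "\<omega> \<in> stopped_at S w"
        using w elim(3) fin by (simp add: stopped_at_def \<tau>_def)
      \<comment> \<open>The local time at y is still 0 at \<open>\<tau>\<close> and positive
        immediately afterwards, which \<open>other\<close> forbids for a landing state different
        from y.\<close>
      ultimately have "w = y"
        using elim(5) y(1) unfolding \<tau>_def by (metis less_irrefl)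
      then show "\<exists>z\<in>B. \<omega> \<in> stopped_at S z"
        using \<open>\<omega> \<in> stopped_at S w\<close> y(1) by blast
    qed
  qed
  show ?thesis using that[OF S pos at before] .
qed


text \<open>The strict comparison of integrals in \<open>potential_decomposition\<close> needs
  measurable integrands. F and R are measurable versions of the local time in total and after S; R
  is glued from one version per landing state, as each law \<open>P z\<close> has its own null
  sets.\<close>

lemma renewal:
  assumes S: "stopping_time (history_plus E) S" and x: "x \<in> topspace E"
    and B: "finite B" "B \<subseteq> topspace E"
    and at: "AE \<omega> in P x. S \<omega> < \<infinity> \<longrightarrow> (\<exists>z\<in>B. \<omega> \<in> stopped_at S z)"
    and L: "local_time_at E P y L"
  obtains F R where "F \<in> borel_measurable (P x)" "R \<in> borel_measurable (P x)"
    "AE \<omega> in P x. F \<omega> = total_local_time L \<omega>"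
    "AE \<omega> in P x. R \<omega> = (if S \<omega> < \<infinity> then total_local_time L (shift_at S \<omega>) else 0)"
    "(\<integral>\<^sup>+\<omega>. R \<omega> \<partial>P x) = (\<Sum>z\<in>B. emeasure (P x) (stopped_at S z) * (\<integral>\<^sup>+\<omega>. total_local_time L \<omega> \<partial>P z))"
proof -
  have "\<forall>w\<in>topspace E. \<exists>F. F \<in> borel_measurable (path_algebra E) \<and> (AE \<omega> in P w. total_local_time L \<omega> = F \<omega>)"
    using total_local_time_version[OF L] by metis
  then obtain F where F: "\<And>w. w \<in> topspace E \<Longrightarrow> F w \<in> borel_measurable (path_algebra E)"
    and LF: "\<And>w. w \<in> topspace E \<Longrightarrow> AE \<omega> in P w. total_local_time L \<omega> = F w \<omega>"
    by metis
  define R where "R \<omega> = (\<Sum>z\<in>B. indicator (stopped_at S z) \<omega> * F z (shift_at S \<omega>))" for \<omega>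
  have meas_eq: "borel_measurable (P x) = borel_measurable (path_algebra E)"
    by (rule measurable_cong_sets[OF sets_P[OF x] refl])
  have summand: "(\<lambda>\<omega>. indicator (stopped_at S z) \<omega> * F z (shift_at S \<omega>)) \<in> borel_measurable (path_algebra E)"
    if "z \<in> B" for z
    using that B(2) stopped_at_measurable[OF S] measurable_compose[OF shift_at_measurable[OF S] F]
    by (intro borel_measurable_times_ennreal borel_measurable_indicator) auto
  have "R \<in> borel_measurable (P x)"
    unfolding meas_eq R_def using summand by (rule borel_measurable_sum)
  moreover have "AE \<omega> in P x. R \<omega> = (if S \<omega> < \<infinity> then total_local_time L (shift_at S \<omega>) else 0)"
  proof -
    have "AE \<omega> in P x. \<forall>z\<in>B. \<omega> \<in> stopped_at S z \<longrightarrow> total_local_time L (shift_at S \<omega>) = F z (shift_at S \<omega>)"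
      using AE_shift_at[OF x _ S LF] B by (simp add: AE_ball_countable countable_finite subset_iff)
    with at show ?thesis
    proof eventually_elim
      case (elim \<omega>)
      show ?case
      proof (cases "S \<omega> < \<infinity>")
        case True
        then obtain z where z: "z \<in> B" "\<omega> \<in> stopped_at S z" using elim by blast
        \<comment> \<open>The landing events are disjoint, so only one summand survives.\<close>
        then have "indicator (stopped_at S w) \<omega> * F w (shift_at S \<omega>) =
            (if w = z then F z (shift_at S \<omega>) else 0)" for w
          by (auto simp: stopped_at_def indicator_def)
        then have "R \<omega> = F z (shift_at S \<omega>)"
          using z B(1) by (simp add: R_def)
        then show ?thesis using z elim(2) True by simp
      qed (auto simp: R_def stopped_at_def)
    qed
  qed
  moreover have "(\<integral>\<^sup>+\<omega>. R \<omega> \<partial>P x) =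
      (\<Sum>z\<in>B. emeasure (P x) (stopped_at S z) * (\<integral>\<^sup>+\<omega>. total_local_time L \<omega> \<partial>P z))"
  proof -
    have "(\<integral>\<^sup>+\<omega>. R \<omega> \<partial>P x) =
        (\<Sum>z\<in>B. \<integral>\<^sup>+\<omega>. indicator (stopped_at S z) \<omega> * F z (shift_at S \<omega>) \<partial>P x)"
      unfolding R_def using summand by (intro nn_integral_sum) (simp add: meas_eq)
    also have "\<dots> = (\<Sum>z\<in>B. emeasure (P x) (stopped_at S z) * (\<integral>\<^sup>+\<omega>. F z \<omega> \<partial>P z))"
      using nn_integral_shift_at[OF x _ S F] B(2) by (intro sum.cong) auto
    also have "\<dots> = (\<Sum>z\<in>B. emeasure (P x) (stopped_at S z) * (\<integral>\<^sup>+\<omega>. total_local_time L \<omega> \<partial>P z))"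
    proof (intro sum.cong refl arg_cong2[where f = "(*)"])
      fix z assume "z \<in> B"
      then have "z \<in> topspace E" using B(2) by blast
      from LF[OF this] have "AE \<omega> in P z. F z \<omega> = total_local_time L \<omega>"
        by eventually_elim simp
      then show "(\<integral>\<^sup>+\<omega>. F z \<omega> \<partial>P z) = (\<integral>\<^sup>+\<omega>. total_local_time L \<omega> \<partial>P z)"
        by (rule nn_integral_cong_AE)
    qed
    finally show ?thesis .
  qed
  moreover have "F x \<in> borel_measurable (P x)" using F[OF x] by (simp add: meas_eq)
  moreover have "AE \<omega> in P x. F x \<omega> = total_local_time L \<omega>"
    using LF[OF x] by eventually_elim simp
  ultimately show ?thesis using that by blast
qed

text \<open>The weight \<open>h z\<close> is the probability that B is first hit at z. For y in B no
  local time at y accrues before S, so all of it is collected after the restart. At x itself a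
  positive amount accrues before S, because S > 0 almost surely, and this makes the last inequality
  strict.\<close>

lemma potential_decomposition:
  assumes x: "x \<in> topspace E" and B: "finite B" "B \<subseteq> topspace E" "x \<notin> B"
    and L: "\<And>y. y \<in> topspace E \<Longrightarrow> local_time_at E P y (L y)"
    and u0: "\<And>w y. w \<in> topspace E \<Longrightarrow> y \<in> topspace E \<Longrightarrow> 0 \<le> u w y"
    and u: "\<And>w y. w \<in> topspace E \<Longrightarrow> y \<in> topspace E \<Longrightarrow>
      (\<integral>\<^sup>+\<omega>. total_local_time (L y) \<omega> \<partial>P w) = ennreal (u w y)"
  obtains h where "\<And>z. z \<in> B \<Longrightarrow> 0 \<le> h z" "\<And>y. y \<in> B \<Longrightarrow> u x y = (\<Sum>z\<in>B. h z * u z y)"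
    "(\<Sum>z\<in>B. h z * u z x) < (u x x :: real)"
proof -
  interpret Px: prob_space "P x" by (rule prob[OF x])
  have LB: "local_time_at E P y (L y)" if "y \<in> B" for y using L B that by blast
  obtain S where S: "stopping_time (history_plus E) S" and pos: "AE \<omega> in P x. 0 < S \<omega>"
    and at: "AE \<omega> in P x. S \<omega> < \<infinity> \<longrightarrow> (\<exists>z\<in>B. \<omega> \<in> stopped_at S z)"
    and before: "AE \<omega> in P x. \<forall>y\<in>B. \<forall>t\<ge>0. ennreal t \<le> S \<omega> \<longrightarrow> L y t \<omega> = 0"
    by (rule hitting_time[OF x B LB])
  define h where "h z = measure (P x) (stopped_at S z)" for z
  have sum_eq: "(\<Sum>z\<in>B. emeasure (P x) (stopped_at S z) * (\<integral>\<^sup>+\<omega>. total_local_time (L y) \<omega> \<partial>P z)) =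
      ennreal (\<Sum>z\<in>B. h z * u z y)" if "y \<in> topspace E" for y
    using B(2) u[OF _ that] u0[OF _ that]
    by (subst sum_ennreal[symmetric]) (auto simp: h_def Px.emeasure_eq_measure subset_iff ennreal_mult intro!: sum.cong)
  have "u x y = (\<Sum>z\<in>B. h z * u z y)" if y: "y \<in> B" for y
  proof -
    have yE: "y \<in> topspace E" using y B by blast
    obtain F R where "F \<in> borel_measurable (P x)" "R \<in> borel_measurable (P x)"
      "AE \<omega> in P x. F \<omega> = total_local_time (L y) \<omega>"
      and FR: "AE \<omega> in P x. R \<omega> = (if S \<omega> < \<infinity> then total_local_time (L y) (shift_at S \<omega>) else 0)"
      "(\<integral>\<^sup>+\<omega>. R \<omega> \<partial>P x) = (\<Sum>z\<in>B. emeasure (P x) (stopped_at S z) * (\<integral>\<^sup>+\<omega>. total_local_time (L y) \<omega> \<partial>P z))"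
      by (rule renewal[OF S x B(1,2) at LB[OF y]])
    from FR(1) before local_time_AE[OF LB[OF y] x] have "AE \<omega> in P x. total_local_time (L y) \<omega> = R \<omega>"
    proof eventually_elim
      case (elim \<omega>)
      show ?case
      proof (cases "S \<omega> < \<infinity>")
        case True
        then have "L y (enn2real (S \<omega>)) \<omega> = 0" using elim(2) y by simp
        then show ?thesis
          using total_local_time_split[OF elim(3), of "enn2real (S \<omega>)"] elim(1) True by simp
      next
        case False
        then have "S \<omega> = \<top>" by (metis infinity_ennreal_def less_top)
        then have "L y t \<omega> = 0" if "0 \<le> t" for t using elim(2) y that by simp
        then have "total_local_time (L y) \<omega> = 0" by (simp add: total_local_time_def)
        then show ?thesis using elim(1) False by simp
      qed
    qed
    then have "ennreal (u x y) = (\<integral>\<^sup>+\<omega>. R \<omega> \<partial>P x)"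
      unfolding u[OF x yE, symmetric] by (rule nn_integral_cong_AE)
    also have "\<dots> = ennreal (\<Sum>z\<in>B. h z * u z y)"
      unfolding FR(2) by (rule sum_eq[OF yE])
    finally show ?thesis
      using u0 x yE B(2) by (subst (asm) ennreal_inj) (auto intro!: sum_nonneg mult_nonneg_nonneg simp: h_def subset_iff)
  qed
  moreover have "(\<Sum>z\<in>B. h z * u z x) < u x x"
  proof -
    obtain F R where FR: "F \<in> borel_measurable (P x)" "R \<in> borel_measurable (P x)"
      "AE \<omega> in P x. F \<omega> = total_local_time (L x) \<omega>"
      "AE \<omega> in P x. R \<omega> = (if S \<omega> < \<infinity> then total_local_time (L x) (shift_at S \<omega>) else 0)"
      "(\<integral>\<^sup>+\<omega>. R \<omega> \<partial>P x) = (\<Sum>z\<in>B. emeasure (P x) (stopped_at S z) * (\<integral>\<^sup>+\<omega>. total_local_time (L x) \<omega> \<partial>P z))"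
      by (rule renewal[OF S x B(1,2) at L[OF x]])
    have intF: "(\<integral>\<^sup>+\<omega>. F \<omega> \<partial>P x) = ennreal (u x x)"
      using nn_integral_cong_AE[OF FR(3)] u[OF x x] by simp
    \<comment> \<open>F is a positive amount plus R when S is finite; this is a strict increase only
      if F is finite.\<close>
    then have "AE \<omega> in P x. F \<omega> \<noteq> \<infinity>"
      by (intro nn_integral_PInf_AE FR(1)) simp
    with FR(3,4) local_time_AE[OF L[OF x] x] local_time_on[OF L[OF x]] pos
    have less: "AE \<omega> in P x. R \<omega> < F \<omega>"
    proof eventually_elim
      case (elim \<omega>)
      show ?case
      proof (cases "S \<omega> < \<infinity>")
        case True
        then have "0 < enn2real (S \<omega>)" using elim(5) by (simp add: enn2real_positive_iff)
        then have "0 < L x (enn2real (S \<omega>)) \<omega>" using elim(4) by simp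
        moreover have "F \<omega> = ennreal (L x (enn2real (S \<omega>)) \<omega>) + R \<omega>"
          using total_local_time_split[OF elim(3), of "enn2real (S \<omega>)"] elim(1,2) True by simp
        ultimately show ?thesis
          using elim(6) by (cases "R \<omega>") (auto simp flip: ennreal_plus simp: ennreal_less_iff)
      next
        case False
        have "0 < ennreal (L x 1 \<omega>)" using elim(4) by simp
        also have "\<dots> \<le> F \<omega>" unfolding elim(1) total_local_time_def by (rule SUP_upper) simp
        finally show ?thesis using elim(2) False by simp
      qed
    qed
    have "(\<integral>\<^sup>+\<omega>. R \<omega> \<partial>P x) < (\<integral>\<^sup>+\<omega>. F \<omega> \<partial>P x)"
    proof (rule nn_integral_less[OF FR(2,1)])
      show le: "AE \<omega> in P x. R \<omega> \<le> F \<omega>" using less by eventually_elim simp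
      then have "(\<integral>\<^sup>+\<omega>. R \<omega> \<partial>P x) \<le> ennreal (u x x)" unfolding intF[symmetric] by (rule nn_integral_mono_AE)
      then show "(\<integral>\<^sup>+\<omega>. R \<omega> \<partial>P x) \<noteq> \<infinity>" by (auto simp: top_unique)
      show "\<not> (AE \<omega> in P x. F \<omega> \<le> R \<omega>)"
      proof
        assume "AE \<omega> in P x. F \<omega> \<le> R \<omega>"
        with less have "AE \<omega> in P x. False" by eventually_elim simp
        then show False by simp
      qed
    qed
    then have "ennreal (\<Sum>z\<in>B. h z * u z x) < ennreal (u x x)"
      unfolding FR(5) sum_eq[OF x] intF .
    then show ?thesis
      using u0 x B(2) by (subst (asm) ennreal_less_iff) (auto intro!: sum_nonneg mult_nonneg_nonneg simp: h_def subset_iff)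
  qed
  moreover have "0 \<le> h z" for z by (simp add: h_def)
  ultimately show ?thesis using that by blast
qed

end

lemma markov_potential_density_decomposition:
  assumes "markov_potential_density T u" "x \<in> T" "finite B" "B \<subseteq> T" "x \<notin> B"
  shows "\<exists>h. (\<forall>z\<in>B. 0 \<le> h z) \<and> (\<forall>y\<in>B. u x y = (\<Sum>z\<in>B. h z * u z y)) \<and>
    (\<Sum>z\<in>B. h z * u z x) < u x x"
proof -
  obtain E :: "'a topology" and P L where
    E: "topspace E = T" "right_process E P" "potential_density E P u" "\<forall>y\<in>T. local_time_at E P y (L y)"
      "\<forall>x\<in>T. \<forall>y\<in>T. (\<integral>\<^sup>+\<omega>. (SUP t\<in>{0..}. ennreal (L y t \<omega>)) \<partial>P x) = ennreal (u x y)"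
    using assms(1) unfolding markov_potential_density_def by blast
  interpret right_process E P by (rule E(2))
  show ?thesis
  proof (rule potential_decomposition[of x B L u])
    show "0 \<le> u w y" if "w \<in> topspace E" "y \<in> topspace E" for w y
      using E(3) that unfolding potential_density_def by blast
    show "(\<integral>\<^sup>+\<omega>. total_local_time (L y) \<omega> \<partial>P w) = ennreal (u w y)"
      if "w \<in> topspace E" "y \<in> topspace E" for w y
      using E(1,5) that unfolding total_local_time_def by simp
    show ?thesis if "\<And>z. z \<in> B \<Longrightarrow> 0 \<le> h z" "\<And>y. y \<in> B \<Longrightarrow> u x y = (\<Sum>z\<in>B. h z * u z y)"
      "(\<Sum>z\<in>B. h z * u z x) < u x x" for h
      using that by blast
  qed (use assms(2-5) E(1,4) in simp_all)
qed

lemma markov_potential_density_nonneg: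
  "markov_potential_density T u \<Longrightarrow> x \<in> T \<Longrightarrow> y \<in> T \<Longrightarrow> 0 \<le> u x y"
  unfolding markov_potential_density_def potential_density_def by blast

subsection \<open>Cones of functions closed under pointwise limits\<close>

text \<open>A substitute for mixtures of laws, on the level of their transforms: an inequality that
  is linear in finitely many values on S passes from the generators through all rules. Limits are
  taken on S alone, so values elsewhere are immaterial (\<open>lim_cone_cong\<close>).\<close>

inductive lim_cone :: "'b set \<Rightarrow> ('b \<Rightarrow> real) set \<Rightarrow> ('b \<Rightarrow> real) \<Rightarrow> bool" for S G where
  base: "g \<in> G \<Longrightarrow> lim_cone S G g"
| add: "lim_cone S G f \<Longrightarrow> lim_cone S G g \<Longrightarrow> lim_cone S G (\<lambda>s. f s + g s)"
| scale: "0 \<le> c \<Longrightarrow> lim_cone S G f \<Longrightarrow> lim_cone S G (\<lambda>s. c * f s)"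
| lim: "(\<And>k::nat. lim_cone S G (f k)) \<Longrightarrow> (\<And>s. s \<in> S \<Longrightarrow> (\<lambda>k. f k s) \<longlonglongrightarrow> g s) \<Longrightarrow> lim_cone S G g"

lemma lim_cone_cong:
  assumes "lim_cone S G f" "\<And>s. s \<in> S \<Longrightarrow> f s = g s"
  shows "lim_cone S G g"
  by (rule lim_cone.lim[of S G "\<lambda>_. f"]) (use assms in auto)

text \<open>Multiplication is linear and continuous in each factor separately; an induction on g
  inside the base case for f leaves only products of generators.\<close>

lemma lim_cone_mult:
  assumes f: "lim_cone S G f" and g: "lim_cone S H g"
    and GH: "\<And>f g. f \<in> G \<Longrightarrow> g \<in> H \<Longrightarrow> lim_cone S J (\<lambda>s. f s * g s)"
  shows "lim_cone S J (\<lambda>s. f s * g s)"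
  using f
proof (induction rule: lim_cone.induct)
  case (base f)
  from g show ?case
  proof (induction rule: lim_cone.induct)
    case (base g)
    from GH[OF \<open>f \<in> G\<close> base] show ?case .
  next
    case (add g h)
    from lim_cone.add[OF add.IH] show ?case by (simp only: distrib_left)
  next
    case (scale c g)
    from lim_cone.scale[OF scale.hyps(1) scale.IH] show ?case by (simp only: mult.left_commute)
  next
    case (lim g h)
    show ?case
      by (rule lim_cone.lim[where f = "\<lambda>k s. f s * g k s"]) (auto intro: lim.IH intro!: tendsto_intros lim.hyps)
  qed
next
  case (add f h)
  from lim_cone.add[OF add.IH] show ?case by (simp only: distrib_right)
next
  case (scale c f)
  from lim_cone.scale[OF scale.hyps(1) scale.IH] show ?case by (simp only: mult.assoc)
next
  case (lim f h)
  show ?case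
    by (rule lim_cone.lim[where f = "\<lambda>k s. f k s * g s"]) (auto intro: lim.IH intro!: tendsto_intros lim.hyps)
qed

lemma lim_cone_nonneg:
  assumes "lim_cone S G f" "\<And>g s. g \<in> G \<Longrightarrow> s \<in> S \<Longrightarrow> 0 \<le> g s" "s \<in> S"
  shows "0 \<le> f s"
  using assms(1)
proof (induction rule: lim_cone.induct)
  case (lim f g)
  then show ?case using assms(3) by (intro LIMSEQ_le_const[of "\<lambda>k. f k s"]) auto
qed (use assms(2,3) in auto)

text \<open>Up to constants, the Laplace transforms of products of independent gamma laws
  with rates \<open>a i\<close> and shapes \<open>\<alpha> + k i\<close> for \<open>i < m\<close>, \<open>k i\<close> for \<open>m \<le> i < n\<close>.\<close>

definition gamma_base :: "(nat \<Rightarrow> real) \<Rightarrow> nat \<Rightarrow> real \<Rightarrow> nat \<Rightarrow> ((nat \<Rightarrow> real) \<Rightarrow> real) set" where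
  "gamma_base a n \<alpha> m =
     {\<lambda>s. (\<Prod>i<m. (a i + s i) powr (- \<alpha>)) * (\<Prod>i<n. inverse (a i + s i) ^ k i) | k. True}"

definition nonneg_args :: "nat \<Rightarrow> (nat \<Rightarrow> real) set" where
  "nonneg_args n = {s. \<forall>i<n. 0 \<le> s i}"

abbreviation gamma_cone where
  "gamma_cone a n \<alpha> m \<equiv> lim_cone (nonneg_args n) (gamma_base a n \<alpha> m)"

lemma gamma_cone_nonneg:
  assumes "\<And>i. i < n \<Longrightarrow> 0 < a i" "s \<in> nonneg_args n" "gamma_cone a n \<alpha> m f"
  shows "0 \<le> f s"
proof (rule lim_cone_nonneg[OF assms(3) _ assms(2)])
  fix g s assume "g \<in> gamma_base a n \<alpha> m" "s \<in> nonneg_args n"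
  then show "0 \<le> g s"
    using assms(1) by (fastforce simp: gamma_base_def nonneg_args_def intro!: mult_nonneg_nonneg prod_nonneg)
qed

text \<open>One factor is kept at level 0, with integer exponents only. If both carried powers
  \<open>-\<alpha>\<close>, the shapes of the product would start at
  \<open>2 * \<alpha>\<close>.\<close>

lemma gamma_cone_mult:
  assumes "gamma_cone a n \<alpha> 0 f" "gamma_cone a n \<alpha> m g"
  shows "gamma_cone a n \<alpha> m (\<lambda>s. f s * g s)"
proof (rule lim_cone_mult[OF assms])
  fix f g assume "f \<in> gamma_base a n \<alpha> 0" "g \<in> gamma_base a n \<alpha> m"
  then obtain k l where
    "f = (\<lambda>s. (\<Prod>i<n. inverse (a i + s i) ^ k i))"
    "g = (\<lambda>s. (\<Prod>i<m. (a i + s i) powr (- \<alpha>)) * (\<Prod>i<n. inverse (a i + s i) ^ l i))"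
    by (auto simp: gamma_base_def)
  then have "(\<lambda>s. f s * g s) = (\<lambda>s. (\<Prod>i<m. (a i + s i) powr (- \<alpha>)) *
      (\<Prod>i<n. inverse (a i + s i) ^ (k i + l i)))"
    by (auto simp: power_add prod.distrib algebra_simps)
  then show "gamma_cone a n \<alpha> m (\<lambda>s. f s * g s)"
    by (intro lim_cone.base) (auto simp: gamma_base_def intro!: exI[of _ "\<lambda>i. k i + l i"])
qed

lemma gamma_cone_const:
  assumes "0 \<le> c"
  shows "gamma_cone a n \<alpha> 0 (\<lambda>_. c)"
proof -
  have "gamma_cone a n \<alpha> 0 (\<lambda>_. 1)"
    unfolding gamma_base_def
    by (rule lim_cone.base, rule CollectI, rule exI[of _ "\<lambda>_. 0"]) simp
  from lim_cone.scale[OF assms this] show ?thesis by simp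
qed

lemma gamma_cone_inverse:
  assumes "i < n"
  shows "gamma_cone a n \<alpha> 0 (\<lambda>s. inverse (a i + s i))"
proof -
  have "(\<Prod>j<n. inverse (a j + s j) ^ (if j = i then 1 else 0)) = inverse (a i + s i)" for s
    using assms by (subst prod.remove[of _ i]) auto
  then show ?thesis
    unfolding gamma_base_def
    by (intro lim_cone.base CollectI exI[of _ "\<lambda>j. if j = i then 1 else 0"]) simp
qed

lemma gamma_cone_power:
  assumes "gamma_cone a n \<alpha> 0 f"
  shows "gamma_cone a n \<alpha> 0 (\<lambda>s. f s ^ k)"
proof (induction k)
  case 0
  show ?case using gamma_cone_const[of 1] by simp
next
  case (Suc k)
  show ?case using gamma_cone_mult[OF assms Suc] by simp
qed

lemma gamma_cone_sum:
  assumes "\<And>i. i < k \<Longrightarrow> gamma_cone a n \<alpha> 0 (f i)"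
  shows "gamma_cone a n \<alpha> 0 (\<lambda>s. \<Sum>i<(k::nat). f i s)"
  using assms
proof (induction k)
  case 0
  show ?case using gamma_cone_const[of 0] by simp
next
  case (Suc k)
  then have "gamma_cone a n \<alpha> 0 (\<lambda>s. (\<Sum>i<k. f i s) + f k s)"
    by (intro lim_cone.add) simp_all
  then show ?case by simp
qed

text \<open>The signs of the generalized binomial coefficient and of the power of -x cancel. The
  Pochhammer form shows that all coefficients are non-negative for \<open>\<gamma> > 0\<close>, as
  the cone demands.\<close>

lemma neg_binomial_sums:
  fixes x \<gamma> :: real
  assumes "0 \<le> x" "x < 1"
  shows "(\<lambda>k. pochhammer \<gamma> k / fact k * x ^ k) sums (1 - x) powr (- \<gamma>)"
proof -
  have "(\<lambda>k. ((- \<gamma>) gchoose k) * (- x) ^ k) sums (1 + (- x)) powr (- \<gamma>)"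
    by (rule gen_binomial_real) (use assms in auto)
  moreover have "((- \<gamma>) gchoose k) * (- x) ^ k = pochhammer \<gamma> k / fact k * x ^ k" for k
  proof -
    have "(- 1) ^ k * (- 1) ^ k = (1 :: real)" by (metis power_mult_distrib mult_minus_left mult_1 minus_minus power_one)
    then show ?thesis by (simp add: gbinomial_pochhammer power_minus[of x])
  qed
  ultimately show ?thesis by simp
qed

lemma gamma_cone_neg_binomial:
  assumes f: "gamma_cone a n \<alpha> 0 f" and "0 < \<gamma>"
    and f01: "\<And>s. s \<in> nonneg_args n \<Longrightarrow> 0 \<le> f s \<and> f s < 1"
  shows "gamma_cone a n \<alpha> 0 (\<lambda>s. (1 - f s) powr (- \<gamma>))"
proof (rule lim_cone.lim)
  show "gamma_cone a n \<alpha> 0 (\<lambda>s. \<Sum>k<N. pochhammer \<gamma> k / fact k * f s ^ k)" for N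
    using \<open>0 < \<gamma>\<close> by (intro gamma_cone_sum lim_cone.scale gamma_cone_power f) (auto intro!: divide_nonneg_nonneg pochhammer_nonneg)
  show "(\<lambda>N. \<Sum>k<N. pochhammer \<gamma> k / fact k * f s ^ k) \<longlonglongrightarrow> (1 - f s) powr (- \<gamma>)"
    if "s \<in> nonneg_args n" for s
    using neg_binomial_sums f01[OF that] by (simp add: sums_def)
qed

lemma gamma_cone_Suc:
  assumes "m < n" "gamma_cone a n \<alpha> m f"
  shows "gamma_cone a n \<alpha> (Suc m) (\<lambda>s. (a m + s m) powr (- \<alpha>) * f s)"
proof -
  have "lim_cone (nonneg_args n) {\<lambda>s. (a m + s m) powr (- \<alpha>)} (\<lambda>s. (a m + s m) powr (- \<alpha>))"
    by (rule lim_cone.base) simp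
  then show ?thesis
  proof (rule lim_cone_mult[OF _ assms(2)])
    fix f g assume f: "f \<in> {\<lambda>s. (a m + s m) powr (- \<alpha>)}" and "g \<in> gamma_base a n \<alpha> m"
    then obtain k where
      "g = (\<lambda>s. (\<Prod>i<m. (a i + s i) powr (- \<alpha>)) * (\<Prod>i<n. inverse (a i + s i) ^ k i))"
      by (auto simp: gamma_base_def)
    with f have "(\<lambda>s. f s * g s) = (\<lambda>s. (\<Prod>i<Suc m. (a i + s i) powr (- \<alpha>)) *
        (\<Prod>i<n. inverse (a i + s i) ^ k i))"
      by (auto simp: algebra_simps)
    then show "gamma_cone a n \<alpha> (Suc m) (\<lambda>s. f s * g s)"
      by (intro lim_cone.base) (auto simp: gamma_base_def)
  qed
qed

subsection \<open>Determinants of semipositive matrices\<close>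

text \<open>Pivoting on the last entry leaves a matrix on the indices below m, in step with the
  induction of \<open>gamma_cone_det\<close>. The unipotent \<open>?L\<close> clears the last column
  above the pivot.\<close>

lemma det_Schur_complement:
  fixes G :: "nat \<Rightarrow> nat \<Rightarrow> real"
  assumes g: "G m m \<noteq> 0"
  shows "Determinant.det (Matrix.mat (Suc m) (Suc m) (\<lambda>(i, j). G i j)) =
    G m m * Determinant.det (Matrix.mat m m (\<lambda>(i, j). G i j - G i m * G m j / G m m))"
proof -
  let ?G = "Matrix.mat (Suc m) (Suc m) (\<lambda>(i, j). G i j)"
  let ?L = "four_block_mat (1\<^sub>m m) (Matrix.mat m 1 (\<lambda>(i, j). - G i m / G m m)) (0\<^sub>m 1 m) (1\<^sub>m 1)"
  let ?S = "Matrix.mat m m (\<lambda>(i, j). G i j - G i m * G m j / G m m)"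
  let ?R = "four_block_mat ?S (0\<^sub>m m 1) (Matrix.mat 1 m (\<lambda>(i, j). G m j)) (Matrix.mat 1 1 (\<lambda>_. G m m))"
  have G4: "?G = four_block_mat (Matrix.mat m m (\<lambda>(i, j). G i j)) (Matrix.mat m 1 (\<lambda>(i, j). G i m))
      (Matrix.mat 1 m (\<lambda>(i, j). G m j)) (Matrix.mat 1 1 (\<lambda>_. G m m))"
    by (rule eq_matI) (auto simp: less_Suc_eq)
  have "1\<^sub>m m * Matrix.mat m m (\<lambda>(i, j). G i j) +
      Matrix.mat m 1 (\<lambda>(i, j). - G i m / G m m) * Matrix.mat 1 m (\<lambda>(i, j). G m j) = ?S"
    by (rule eq_matI) (auto simp: scalar_prod_def)
  moreover have "1\<^sub>m m * Matrix.mat m 1 (\<lambda>(i, j). G i m) +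
      Matrix.mat m 1 (\<lambda>(i, j). - G i m / G m m) * Matrix.mat 1 1 (\<lambda>_. G m m) = 0\<^sub>m m 1"
    by (rule eq_matI) (use g in \<open>auto simp: scalar_prod_def\<close>)
  ultimately have "?L * ?G = ?R"
    unfolding G4
    by (subst mult_four_block_mat[where ?n1.0 = m and ?n2.0 = 1 and ?nr1.0 = m and ?nr2.0 = 1 and ?nc1.0 = m and ?nc2.0 = 1])
       auto
  then have "Determinant.det ?L * Determinant.det ?G = Determinant.det ?R"
    by (subst det_mult[of _ "Suc m", symmetric]) auto
  moreover have "Determinant.det ?L = 1"
    by (subst det_four_block_mat_lower_left_zero[where n = m and m = 1]) auto
  moreover have "Determinant.det ?R = Determinant.det ?S * G m m"
    by (subst det_four_block_mat_upper_right_zero[where n = m and m = 1])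
       (auto simp: det_single)
  ultimately show ?thesis by simp
qed

text \<open>Semipositivity (some positive vector has a positive image) replaces inverse positivity as
  the description of M-matrices, because it is stable under Schur complements and under
  adding a non-negative diagonal.\<close>

lemma semipositive_pivot:
  fixes G :: "nat \<Rightarrow> nat \<Rightarrow> real"
  assumes off: "\<And>i j. i \<le> m \<Longrightarrow> j \<le> m \<Longrightarrow> i \<noteq> j \<Longrightarrow> G i j \<le> 0"
    and v: "\<And>i. i \<le> m \<Longrightarrow> 0 < v i" and Gv: "\<And>i. i \<le> m \<Longrightarrow> 0 < (\<Sum>j<Suc m. G i j * v j)"
  shows "0 < G m m"
    and "i < m \<Longrightarrow> 0 < (\<Sum>j<m. (G i j - G i m * G m j / G m m) * v j)"
proof -
  let ?r = "\<Sum>j<m. G m j * v j"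
  have "?r \<le> 0"
    by (auto intro!: sum_nonpos mult_nonpos_nonneg off less_imp_le[OF v])
  with Gv[of m] have r: "- ?r < G m m * v m" and "0 < G m m * v m" by auto
  with v[of m] show g: "0 < G m m"
    by (simp add: zero_less_mult_iff)
  show "0 < (\<Sum>j<m. (G i j - G i m * G m j / G m m) * v j)" if i: "i < m"
  proof -
    \<comment> \<open>The last row of G v > 0, solved for \<open>v m\<close>. Since
      \<open>G i m \<le> 0\<close>, replacing \<open>v m\<close> by this lower bound in row i can
      only increase its value, and the result is row i of the Schur complement.\<close>
    have "- ?r / G m m < v m"
      by (subst pos_divide_less_eq[OF g]) (use r in \<open>simp only: mult.commute\<close>)
    moreover have "G i m \<le> 0" using off i by simp
    ultimately have "G i m * v m \<le> G i m * (- ?r / G m m)"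
      by (intro mult_left_mono_neg) auto
    then have "0 < (\<Sum>j<m. G i j * v j) - G i m / G m m * ?r"
      using Gv[of i] i by simp
    also have "\<dots> = (\<Sum>j<m. (G i j - G i m * G m j / G m m) * v j)"
      by (simp add: sum_distrib_left algebra_simps sum_subtractf)
    finally show ?thesis .
  qed
qed

text \<open>Eliminating index m, the pivot is (a_m + s_m)(1 - x) with x = b_mm / (a_m + s_m), and
  semipositivity gives 0 <= x < 1. Hence both the inverse of the pivot and its power
  \<open>-\<alpha>\<close> expand with non-negative coefficients. The Schur complement has the same
  shape diag(a + s) - b' with b' = b + b_im b_mj / pivot again in the cone. For this to iterate, b
  must be allowed to depend on s, and so must the vector v.\<close>

lemma gamma_cone_det:
  fixes a :: "nat \<Rightarrow> real" and b :: "nat \<Rightarrow> nat \<Rightarrow> (nat \<Rightarrow> real) \<Rightarrow> real"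
  defines "G \<equiv> \<lambda>b s i j. (if i = j then a i + s i else 0) - b i j s"
  assumes "0 < \<alpha>" and a: "\<And>i. i < n \<Longrightarrow> 0 < a i" and "m \<le> n"
    and "\<And>i j. i < m \<Longrightarrow> j < m \<Longrightarrow> gamma_cone a n \<alpha> 0 (b i j)"
    and "\<And>s. s \<in> nonneg_args n \<Longrightarrow>
          \<exists>v. \<forall>i<m. 0 < v i \<and> 0 < (\<Sum>j<m. G b s i j * v j)"
  shows "gamma_cone a n \<alpha> m (\<lambda>s. Determinant.det (Matrix.mat m m (\<lambda>(i, j). G b s i j)) powr (- \<alpha>))
    \<and> (\<forall>s\<in>nonneg_args n. 0 < Determinant.det (Matrix.mat m m (\<lambda>(i, j). G b s i j)))"
  using assms(4-)
proof (induction m arbitrary: b)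
  case 0
  then show ?case using gamma_cone_const[of 1] by (simp add: det_def)
next
  case (Suc m)
  let ?S = "nonneg_args n"
  have m: "m < n" using Suc.prems by simp
  have b0: "0 \<le> b i j s" if "s \<in> ?S" "i \<le> m" "j \<le> m" for i j s
    using gamma_cone_nonneg[OF a that(1) Suc.prems(2)] that by simp
  have pos: "0 < a m + s m" if "s \<in> ?S" for s
    using that a[OF m] m by (auto simp: nonneg_args_def add_pos_nonneg)
  have ex: "0 < G b s m m \<and> (\<exists>v. \<forall>i<m. 0 < v i \<and>
      0 < (\<Sum>j<m. (G b s i j - G b s i m * G b s m j / G b s m m) * v j))" if s: "s \<in> ?S" for s
  proof -
    obtain v where v: "\<And>i. i \<le> m \<Longrightarrow> 0 < v i" "\<And>i. i \<le> m \<Longrightarrow> 0 < (\<Sum>j<Suc m. G b s i j * v j)"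
      using Suc.prems(3)[OF s] by (auto simp: less_Suc_eq_le)
    have off: "G b s i j \<le> 0" if "i \<le> m" "j \<le> m" "i \<noteq> j" for i j
      using b0[OF s] that by (simp add: G_def)
    show ?thesis
      using semipositive_pivot[of m "G b s" v, OF off v] v(1) by (intro conjI exI[of _ v]) auto
  qed
  define x where "x = (\<lambda>s. b m m s * inverse (a m + s m))"
  have x: "gamma_cone a n \<alpha> 0 x"
    unfolding x_def by (intro gamma_cone_mult gamma_cone_inverse m Suc.prems) auto
  have gx: "G b s m m = (a m + s m) * (1 - x s)" if "s \<in> ?S" for s
    using pos[OF that] by (simp add: G_def x_def field_simps)
  have x01: "0 \<le> x s \<and> x s < 1" if s: "s \<in> ?S" for s
  proof
    show "0 \<le> x s" using gamma_cone_nonneg[OF a s x] .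
    show "x s < 1" using ex[OF s] gx[OF s] pos[OF s] by (simp add: zero_less_mult_iff)
  qed
  \<comment> \<open>The reciprocal of 1 - x is written with \<open>powr (- 1)\<close> to fit
    \<open>gamma_cone_neg_binomial\<close> with \<open>\<gamma> = 1\<close>.\<close>
  define b' where "b' = (\<lambda>i j s. b i j s + (b i m s * b m j s) *
      (inverse (a m + s m) * (1 - x s) powr (- 1)))"
  have b': "gamma_cone a n \<alpha> 0 (b' i j)" if "i < m" "j < m" for i j
    unfolding b'_def
    by (intro lim_cone.add gamma_cone_mult gamma_cone_inverse gamma_cone_neg_binomial x x01 m)
       (use that Suc.prems in auto)
  have Gb': "G b' s i j = G b s i j - G b s i m * G b s m j / G b s m m"
    if "s \<in> ?S" "i < m" "j < m" for s i j
  proof -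
    have "inverse (a m + s m) * (1 - x s) powr (- 1) = inverse (G b s m m)"
      using gx[OF that(1)] x01[OF that(1)] by (simp add: powr_minus)
    then have "b' i j s = b i j s + b i m s * b m j s / G b s m m"
      by (simp only: b'_def divide_inverse)
    moreover have "G b s i m * G b s m j = b i m s * b m j s"
      using that by (simp add: G_def)
    ultimately show ?thesis by (simp add: G_def)
  qed
  have IH: "gamma_cone a n \<alpha> m (\<lambda>s. Determinant.det (Matrix.mat m m (\<lambda>(i, j). G b' s i j)) powr (- \<alpha>))
    \<and> (\<forall>s\<in>nonneg_args n. 0 < Determinant.det (Matrix.mat m m (\<lambda>(i, j). G b' s i j)))"
  proof (rule Suc.IH)
    show "\<exists>v. \<forall>i<m. 0 < v i \<and> 0 < (\<Sum>j<m. G b' s i j * v j)" if "s \<in> ?S" for s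
      using ex[OF that] Gb'[OF that] by simp
  qed (use m b' in auto)
  have det: "Determinant.det (Matrix.mat (Suc m) (Suc m) (\<lambda>(i, j). G b s i j)) =
      (a m + s m) * (1 - x s) * Determinant.det (Matrix.mat m m (\<lambda>(i, j). G b' s i j))"
    if s: "s \<in> ?S" for s
  proof -
    have "Matrix.mat m m (\<lambda>(i, j). G b' s i j) =
        Matrix.mat m m (\<lambda>(i, j). G b s i j - G b s i m * G b s m j / G b s m m)"
      by (rule eq_matI) (use Gb'[OF s] in auto)
    then have "Determinant.det (Matrix.mat (Suc m) (Suc m) (\<lambda>(i, j). G b s i j)) =
        G b s m m * Determinant.det (Matrix.mat m m (\<lambda>(i, j). G b' s i j))"
      using det_Schur_complement[of "G b s" m] ex[OF s] by simp
    then show ?thesis by (simp only: gx[OF s])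
  qed
  have detpos: "0 < Determinant.det (Matrix.mat (Suc m) (Suc m) (\<lambda>(i, j). G b s i j))"
    if s: "s \<in> ?S" for s
    unfolding det[OF s] using pos[OF s] x01[OF s] IH s by simp
  have "gamma_cone a n \<alpha> (Suc m) (\<lambda>s. (a m + s m) powr (- \<alpha>) * ((1 - x s) powr (- \<alpha>) *
     Determinant.det (Matrix.mat m m (\<lambda>(i, j). G b' s i j)) powr (- \<alpha>)))"
    by (intro gamma_cone_Suc gamma_cone_mult gamma_cone_neg_binomial x x01 m) (use IH \<open>0 < \<alpha>\<close> in auto)
  then have "gamma_cone a n \<alpha> (Suc m)
      (\<lambda>s. Determinant.det (Matrix.mat (Suc m) (Suc m) (\<lambda>(i, j). G b s i j)) powr (- \<alpha>))"
  proof (rule lim_cone_cong)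
    fix s assume s: "s \<in> ?S"
    show "(a m + s m) powr (- \<alpha>) * ((1 - x s) powr (- \<alpha>) *
       Determinant.det (Matrix.mat m m (\<lambda>(i, j). G b' s i j)) powr (- \<alpha>)) =
       Determinant.det (Matrix.mat (Suc m) (Suc m) (\<lambda>(i, j). G b s i j)) powr (- \<alpha>)"
      unfolding det[OF s] using pos[OF s] x01[OF s] IH s by (simp add: powr_mult less_imp_le)
  qed
  then show ?case using detpos by simp
qed

subsection \<open>Gamma distributions\<close>

definition gamma_weight :: "real \<Rightarrow> real \<Rightarrow> real" where
  "gamma_weight \<beta> y = indicator {0<..} y * (y powr (\<beta> - 1) * exp (- y))"

text \<open>For positive \<open>\<beta>\<close> and non-negative x this is the regularized upper
  incomplete gamma function, the survival function of the unit-rate gamma law.\<close>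

definition gamma_tail :: "real \<Rightarrow> real \<Rightarrow> real" where
  "gamma_tail \<beta> x = (\<integral>y. gamma_weight \<beta> y * indicator {x<..} y \<partial>lborel) / Gamma \<beta>"

lemma gamma_weight_measurable [measurable]: "gamma_weight \<beta> \<in> borel_measurable borel"
  unfolding gamma_weight_def by measurable

lemma gamma_weight_nonneg: "0 \<le> gamma_weight \<beta> y"
  by (simp add: gamma_weight_def)

text \<open>Substitute t = (1 + c) y in the integral of the Gamma function.\<close>

lemma gamma_weight_Laplace:
  assumes \<beta>: "0 < \<beta>" and c: "0 \<le> c"
  shows "has_bochner_integral lborel (\<lambda>y. gamma_weight \<beta> y * exp (- c * y)) (Gamma \<beta> * (1 + c) powr (- \<beta>))"
proof -
  have k: "0 < 1 + c" using c by simp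
  let ?f = "\<lambda>t. ennreal (indicator {0..} t * t powr (\<beta> - 1) / exp t)"
  let ?J = "\<integral>\<^sup>+y. ennreal (gamma_weight \<beta> y * exp (- c * y)) \<partial>lborel"
  have "ennreal (Gamma \<beta>) = (\<integral>\<^sup>+t. ?f t \<partial>lborel)"
    using Gamma_conv_nn_integral_real[OF \<beta>] .
  also have "\<dots> = ennreal \<bar>1 + c\<bar> * (\<integral>\<^sup>+x. ?f (0 + (1 + c) * x) \<partial>lborel)"
    using k by (intro nn_integral_real_affine) auto
  also have "(\<integral>\<^sup>+x. ?f (0 + (1 + c) * x) \<partial>lborel) =
      (\<integral>\<^sup>+y. ennreal ((1 + c) powr (\<beta> - 1)) * ennreal (gamma_weight \<beta> y * exp (- c * y)) \<partial>lborel)"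
  proof (rule nn_integral_cong_AE)
    have "AE y in lborel. y \<noteq> (0::real)" by (rule AE_lborel_singleton)
    then show "AE y in lborel. ?f (0 + (1 + c) * y) =
        ennreal ((1 + c) powr (\<beta> - 1)) * ennreal (gamma_weight \<beta> y * exp (- c * y))"
    proof eventually_elim
      case (elim y)
      show ?case
      proof (cases "0 < y")
        case True
        have p: "((1 + c) * y) powr (\<beta> - 1) = (1 + c) powr (\<beta> - 1) * y powr (\<beta> - 1)"
          by (rule powr_mult)
        have "inverse (exp ((1 + c) * y)) = exp (- y) * exp (- c * y)"
          by (simp add: algebra_simps flip: exp_minus exp_add)
        then have "((1 + c) * y) powr (\<beta> - 1) / exp ((1 + c) * y) =
            (1 + c) powr (\<beta> - 1) * (y powr (\<beta> - 1) * exp (- y) * exp (- c * y))"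
          by (simp only: p divide_inverse mult.assoc)
        then show ?thesis using True k by (simp add: gamma_weight_def ennreal_mult'[symmetric])
      next
        case False
        then have "(1 + c) * y < 0" using elim k by (simp add: mult_pos_neg)
        then show ?thesis using False by (simp add: gamma_weight_def)
      qed
    qed
  qed
  also have "\<dots> = ennreal ((1 + c) powr (\<beta> - 1)) * ?J"
    by (rule nn_integral_cmult) measurable
  finally have J: "ennreal (Gamma \<beta>) = ennreal ((1 + c) powr \<beta>) * ?J"
    using k by (simp add: powr_diff mult.assoc[symmetric] ennreal_mult'[symmetric])
  have "?J = ennreal (Gamma \<beta> * (1 + c) powr (- \<beta>))"
  proof -
    have "ennreal ((1 + c) powr (- \<beta>)) * ennreal (Gamma \<beta>) = ennreal ((1 + c) powr (- \<beta>) * (1 + c) powr \<beta>) * ?J"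
      unfolding J by (simp add: ennreal_mult' mult.assoc)
    then show ?thesis
      using k \<beta> by (simp add: powr_minus ennreal_mult'[symmetric] mult.commute)
  qed
  then show ?thesis
    using \<beta> by (intro has_bochner_integral_nn_integral) (auto simp: gamma_weight_nonneg Gamma_real_pos less_imp_le intro!: AE_I2)
qed

lemma gamma_weight_integral:
  assumes "0 < \<beta>"
  shows "has_bochner_integral lborel (gamma_weight \<beta>) (Gamma \<beta>)"
  using gamma_weight_Laplace[OF assms, of 0] by simp

lemma gamma_weight_integrable:
  assumes "0 < \<beta>" and [measurable]: "f \<in> borel_measurable borel" and "\<And>y. \<bar>f y\<bar> \<le> (C::real)"
  shows "integrable lborel (\<lambda>y. gamma_weight \<beta> y * f y)"
proof (rule Bochner_Integration.integrable_bound)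
  show "integrable lborel (\<lambda>y. C * gamma_weight \<beta> y)"
    using gamma_weight_integral[OF assms(1)] by (auto simp: has_bochner_integral_iff)
  show "AE y in lborel. norm (gamma_weight \<beta> y * f y) \<le> norm (C * gamma_weight \<beta> y)"
  proof (rule AE_I2)
    fix y
    show "norm (gamma_weight \<beta> y * f y) \<le> norm (C * gamma_weight \<beta> y)"
      using mult_right_mono[OF order.trans[OF assms(3) abs_ge_self] gamma_weight_nonneg]
      by (simp add: abs_mult gamma_weight_nonneg mult.commute)
  qed
qed measurable

text \<open>Raising the shape by 1 multiplies the density by y, which is at most x below x and at
  least x above. So A1 <= x A and x B <= B1, hence A1 B <= x A B <= B1 A, and the share of the upper
  part grows.\<close>

lemma gamma_tail_mono:
  assumes \<beta>: "0 < \<beta>" and x: "0 \<le> x"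
  shows "gamma_tail \<beta> x \<le> gamma_tail (\<beta> + 1) x"
proof -
  let ?w = "gamma_weight \<beta>" and ?w1 = "gamma_weight (\<beta> + 1)"
  define A where "A = (\<integral>y. ?w y * indicator {..x} y \<partial>lborel)"
  define B where "B = (\<integral>y. ?w y * indicator {x<..} y \<partial>lborel)"
  define A1 where "A1 = (\<integral>y. ?w1 y * indicator {..x} y \<partial>lborel)"
  define B1 where "B1 = (\<integral>y. ?w1 y * indicator {x<..} y \<partial>lborel)"
  have w1: "?w1 y = y * ?w y" for y
    by (cases "0 < y") (simp_all add: gamma_weight_def powr_diff)
  have int: "integrable lborel (\<lambda>y. gamma_weight \<gamma> y * indicator S y)" if "0 < \<gamma>" "S \<in> sets borel" for \<gamma> S
    using that by (intro gamma_weight_integrable[where C = 1]) (auto simp: indicator_def)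
  have split: "(\<integral>y. gamma_weight \<gamma> y * indicator {..x} y \<partial>lborel) + (\<integral>y. gamma_weight \<gamma> y * indicator {x<..} y \<partial>lborel) = Gamma \<gamma>"
    if "0 < \<gamma>" for \<gamma>
  proof -
    have "(\<integral>y. gamma_weight \<gamma> y * indicator {..x} y + gamma_weight \<gamma> y * indicator {x<..} y \<partial>lborel) = (\<integral>y. gamma_weight \<gamma> y \<partial>lborel)"
      by (intro Bochner_Integration.integral_cong) (auto simp: indicator_def)
    then show ?thesis
      using gamma_weight_integral[OF that] int[OF that]
      by (simp add: has_bochner_integral_iff Bochner_Integration.integral_add)
  qed
  have "A1 \<le> (\<integral>y. x * (?w y * indicator {..x} y) \<partial>lborel)"
    unfolding A1_def
  proof (rule integral_mono)
    show "?w1 y * indicator {..x} y \<le> x * (?w y * indicator {..x} y)" for y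
      using mult_right_mono[OF _ gamma_weight_nonneg, of y x] by (auto simp: w1 indicator_def)
  qed (use int \<beta> in auto)
  then have "A1 \<le> x * A" by (simp add: A_def)
  moreover have "(\<integral>y. x * (?w y * indicator {x<..} y) \<partial>lborel) \<le> B1"
    unfolding B1_def
  proof (rule integral_mono)
    show "x * (?w y * indicator {x<..} y) \<le> ?w1 y * indicator {x<..} y" for y
      using mult_right_mono[OF _ gamma_weight_nonneg, of x y] by (auto simp: w1 indicator_def)
  qed (use int \<beta> in auto)
  then have "x * B \<le> B1" by (simp add: B_def)
  moreover have "0 \<le> A" "0 \<le> B"
    unfolding A_def B_def by (auto intro!: integral_nonneg_AE AE_I2 simp: gamma_weight_nonneg)
  ultimately have "A1 * B \<le> x * A * B" "x * B * A \<le> B1 * A"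
    by (auto intro: mult_right_mono)
  then have "A1 * B \<le> B1 * A" by (simp add: mult_ac)
  moreover have "A + B = Gamma \<beta>" "A1 + B1 = Gamma (\<beta> + 1)"
    unfolding A_def B_def A1_def B1_def using split \<beta> by auto
  moreover have "B * (A1 + B1) \<le> B1 * (A + B)"
    using \<open>A1 * B \<le> B1 * A\<close> by (simp add: algebra_simps)
  ultimately have "B * Gamma (\<beta> + 1) \<le> B1 * Gamma \<beta>" by simp
  then show ?thesis
    using Gamma_real_pos[of \<beta>] Gamma_real_pos[of "\<beta> + 1"] \<beta>
    by (simp add: gamma_tail_def B_def B1_def divide_simps)
qed

lemma gamma_tail_mono_nat:
  assumes "0 < \<beta>" "0 \<le> x"
  shows "gamma_tail \<beta> x \<le> gamma_tail (\<beta> + real k) x"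
proof (induction k)
  case (Suc k)
  also have "gamma_tail (\<beta> + real k) x \<le> gamma_tail (\<beta> + real k + 1) x"
    using assms by (intro gamma_tail_mono) auto
  finally show ?case by (simp add: add_ac)
qed simp

text \<open>Only the stretch from x + 1 to x + 2 is kept. There y is at least 1, so the power of y
  is at least 1/y, hence at least exp(-y), and the density is at least exp(-2y). The wasteful rate 2
  is absorbed later by the factor 4 in \<open>Q\<close>.\<close>

lemma gamma_tail_lower_bound:
  assumes \<beta>: "0 < \<beta>" and x: "0 \<le> x"
  shows "exp (- 4) / Gamma \<beta> * exp (- 2 * x) \<le> gamma_tail \<beta> x"
proof -
  have "exp (- 4) * exp (- 2 * x) = (\<integral>y. exp (- 2 * (x + 2)) * indicator {x + 1..x + 2} y \<partial>lborel)"
    by (simp flip: exp_add)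
  also have "\<dots> \<le> (\<integral>y. gamma_weight \<beta> y * indicator {x<..} y \<partial>lborel)"
  proof (rule integral_mono)
    show "integrable lborel (\<lambda>y. gamma_weight \<beta> y * indicator {x<..} y :: real)"
      using \<beta> by (intro gamma_weight_integrable[where C = 1]) (auto simp: indicator_def)
    fix y
    show "exp (- 2 * (x + 2)) * indicator {x + 1..x + 2} y \<le> gamma_weight \<beta> y * indicator {x<..} y"
    proof (cases "y \<in> {x + 1..x + 2}")
      case True
      then have y: "1 \<le> y" "y \<le> x + 2" using x by auto
      have "exp (- y) \<le> inverse y"
      proof -
        have "y \<le> exp y" using exp_ge_add_one_self[of y] by linarith
        then show ?thesis using y by (simp add: exp_minus le_imp_inverse_le)
      qed
      also have "inverse y = y powr (- 1)" using y by (simp add: powr_minus)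
      also have "\<dots> \<le> y powr (\<beta> - 1)" using y \<beta> by (intro powr_mono) auto
      finally have "exp (- y) * exp (- y) \<le> y powr (\<beta> - 1) * exp (- y)"
        by (rule mult_right_mono) simp
      moreover have "exp (- 2 * (x + 2)) \<le> exp (- y) * exp (- y)"
        using y by (simp flip: exp_add)
      ultimately have "exp (- 2 * (x + 2)) \<le> y powr (\<beta> - 1) * exp (- y)" by (rule order.trans[rotated])
      then show ?thesis
        using True x by (auto simp: gamma_weight_def indicator_def)
    next
      case False
      then show ?thesis by (simp add: gamma_weight_nonneg)
    qed
  qed (auto intro!: integrable_mult_right integrable_real_indicator)
  finally show ?thesis
    using Gamma_real_pos[OF \<beta>] by (simp add: gamma_tail_def divide_right_mono field_simps)
qed

text \<open>If Y is gamma with shape \<open>\<beta>\<close> and rate a, then E exp(-mY) is (a +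
  m)^(-beta) divided by a^(-beta). Up to that normalization the sums are therefore E p(exp(-Y)),
  which lies between 0 and P(Y <= L) + \<open>\<eta>\<close>. Monotonicity in the shape then
  replaces \<open>\<beta>\<close> by \<open>\<alpha>\<close>, making the bound uniform in k.\<close>

lemma gamma_polynomial_bound:
  fixes c :: "nat \<Rightarrow> real" and k :: nat
  assumes a: "0 < a" and \<alpha>: "0 < \<alpha>" and L: "0 \<le> L" and \<eta>: "0 \<le> \<eta>"
    and c0: "\<And>x. 0 \<le> x \<Longrightarrow> 0 \<le> (\<Sum>m\<le>N. c m * exp (- x) ^ m)"
    and c1: "\<And>x. 0 \<le> x \<Longrightarrow> (\<Sum>m\<le>N. c m * exp (- x) ^ m) \<le> indicator {..L} x + \<eta>"
  defines "\<beta> \<equiv> \<alpha> + real k"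
  shows "0 \<le> (\<Sum>m\<le>N. c m * (a + real m) powr (- \<beta>))"
    and "(\<Sum>m\<le>N. c m * (a + real m) powr (- \<beta>)) \<le> a powr (- \<beta>) * (1 - gamma_tail \<alpha> (a * L) + \<eta>)"
proof -
  have \<beta>: "0 < \<beta>" and G: "0 < Gamma \<beta>" using \<alpha> by (auto simp: \<beta>_def intro: Gamma_real_pos)
  define I where "I = (\<integral>y. gamma_weight \<beta> y * (\<Sum>m\<le>N. c m * exp (- (y / a)) ^ m) \<partial>lborel)"
  have "has_bochner_integral lborel (\<lambda>y. \<Sum>m\<le>N. c m * (gamma_weight \<beta> y * exp (- (real m / a) * y)))
      (\<Sum>m\<le>N. c m * (Gamma \<beta> * (1 + real m / a) powr (- \<beta>)))"
    using a \<beta> by (intro has_bochner_integral_sum has_bochner_integral_mult_right gamma_weight_Laplace) auto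
  also have "(\<lambda>y. \<Sum>m\<le>N. c m * (gamma_weight \<beta> y * exp (- (real m / a) * y))) =
      (\<lambda>y. gamma_weight \<beta> y * (\<Sum>m\<le>N. c m * exp (- (y / a)) ^ m))"
    by (simp add: sum_distrib_left mult_ac flip: exp_of_nat_mult)
  finally have hb: "has_bochner_integral lborel (\<lambda>y. gamma_weight \<beta> y * (\<Sum>m\<le>N. c m * exp (- (y / a)) ^ m))
      (\<Sum>m\<le>N. c m * (Gamma \<beta> * (1 + real m / a) powr (- \<beta>)))" .
  have "(\<Sum>m\<le>N. c m * (a + real m) powr (- \<beta>)) = a powr (- \<beta>) / Gamma \<beta> * (\<Sum>m\<le>N. c m * (Gamma \<beta> * (1 + real m / a) powr (- \<beta>)))"
  proof -
    have "(a + real m) powr (- \<beta>) = a powr (- \<beta>) * (1 + real m / a) powr (- \<beta>)" for m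
    proof -
      have "a + real m = a * (1 + real m / a)" using a by (simp add: field_simps)
      then show ?thesis using a powr_mult[of a "1 + real m / a"] by simp
    qed
    then show ?thesis using G by (simp add: sum_distrib_left mult_ac)
  qed
  also have "(\<Sum>m\<le>N. c m * (Gamma \<beta> * (1 + real m / a) powr (- \<beta>))) = I"
    using hb by (simp add: I_def has_bochner_integral_iff)
  finally have sumI: "(\<Sum>m\<le>N. c m * (a + real m) powr (- \<beta>)) = a powr (- \<beta>) / Gamma \<beta> * I" .
  have c0': "0 \<le> gamma_weight \<beta> y * (\<Sum>m\<le>N. c m * exp (- (y / a)) ^ m)" for y
    using c0[of "y / a"] a by (cases "0 < y") (auto simp: gamma_weight_def)
  then have "0 \<le> I" unfolding I_def by (intro integral_nonneg_AE AE_I2)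
  then show "0 \<le> (\<Sum>m\<le>N. c m * (a + real m) powr (- \<beta>))"
    unfolding sumI using G by simp
  have int: "integrable lborel (\<lambda>y. gamma_weight \<beta> y * indicator {a * L<..} y :: real)"
    using \<beta> by (intro gamma_weight_integrable[where C = 1]) (auto simp: indicator_def)
  have "I \<le> (\<integral>y. (1 + \<eta>) * gamma_weight \<beta> y - gamma_weight \<beta> y * indicator {a * L<..} y \<partial>lborel)"
    unfolding I_def
  proof (rule integral_mono)
    show "integrable lborel (\<lambda>y. gamma_weight \<beta> y * (\<Sum>m\<le>N. c m * exp (- (y / a)) ^ m))"
      using hb by (simp add: has_bochner_integral_iff)
    show "integrable lborel (\<lambda>y. (1 + \<eta>) * gamma_weight \<beta> y - gamma_weight \<beta> y * indicator {a * L<..} y)"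
      using gamma_weight_integral[OF \<beta>] int by (auto simp: has_bochner_integral_iff)
    fix y :: real
    show "gamma_weight \<beta> y * (\<Sum>m\<le>N. c m * exp (- (y / a)) ^ m) \<le>
        (1 + \<eta>) * gamma_weight \<beta> y - gamma_weight \<beta> y * indicator {a * L<..} y"
    proof (cases "0 < y")
      case True
      have "(\<Sum>m\<le>N. c m * exp (- (y / a)) ^ m) \<le> indicator {..L} (y / a) + \<eta>"
        using True a by (intro c1) simp
      also have "indicator {..L} (y / a) = (1 - indicator {a * L<..} y :: real)"
        using a by (auto simp: indicator_def field_simps)
      finally have "gamma_weight \<beta> y * (\<Sum>m\<le>N. c m * exp (- (y / a)) ^ m) \<le>
          gamma_weight \<beta> y * (1 - indicator {a * L<..} y + \<eta>)"
        by (rule mult_left_mono[OF _ gamma_weight_nonneg])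
      then show ?thesis by (simp add: algebra_simps)
    qed (simp add: gamma_weight_def)
  qed
  also have "\<dots> = Gamma \<beta> * (1 - gamma_tail \<beta> (a * L) + \<eta>)"
    using gamma_weight_integral[OF \<beta>] int G
    by (simp add: has_bochner_integral_iff gamma_tail_def field_simps)
  also have "\<dots> \<le> Gamma \<beta> * (1 - gamma_tail \<alpha> (a * L) + \<eta>)"
    using G gamma_tail_mono_nat[OF \<alpha>, of "a * L" k] a L by (intro mult_left_mono) (auto simp: \<beta>_def)
  finally have "I \<le> Gamma \<beta> * (1 - gamma_tail \<alpha> (a * L) + \<eta>)" .
  then have "a powr (- \<beta>) / Gamma \<beta> * I \<le> a powr (- \<beta>) / Gamma \<beta> * (Gamma \<beta> * (1 - gamma_tail \<alpha> (a * L) + \<eta>))"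
    using G by (intro mult_left_mono) auto
  then show "(\<Sum>m\<le>N. c m * (a + real m) powr (- \<beta>)) \<le> a powr (- \<beta>) * (1 - gamma_tail \<alpha> (a * L) + \<eta>)"
    unfolding sumI using G by simp
qed

text \<open>Weierstrass approximation in the variable y = exp(-x), which stays in the unit interval.
  The gap between L and L + 1 leaves room for a continuous ramp.\<close>

lemma exponential_polynomial_cutoff:
  fixes L \<eta> :: real
  assumes "0 < L" and \<eta>: "0 < \<eta>"
  obtains c :: "nat \<Rightarrow> real" and N where
    "\<And>x. 0 \<le> x \<Longrightarrow> indicator {..L} x \<le> (\<Sum>m\<le>N. c m * exp (- x) ^ m)"
    "\<And>x. 0 \<le> x \<Longrightarrow> (\<Sum>m\<le>N. c m * exp (- x) ^ m) \<le> indicator {..L + 1} x + \<eta>"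
proof -
  define l where "l = exp (- (L + 1))"
  define r where "r = exp (- L)"
  have lr: "l < r" by (simp add: l_def r_def)
  \<comment> \<open>The ramp is lifted by \<open>\<eta> / 2\<close> so that an approximation within
    \<open>\<eta> / 2\<close> still dominates the indicator.\<close>
  define g where "g y = \<eta> / 2 + max 0 (min 1 ((y - l) / (r - l)))" for y
  have "continuous_on {0..1} g"
    unfolding g_def using lr by (intro continuous_intros) auto
  then obtain p where p: "real_polynomial_function p" "\<And>y. y \<in> {0..1} \<Longrightarrow> \<bar>g y - p y\<bar> < \<eta> / 2"
    using Stone_Weierstrass_real_polynomial_function[of "{0..1}" g "\<eta> / 2"] \<eta> by auto
  then obtain c N where cN: "p = (\<lambda>y. \<Sum>m\<le>N. c m * y ^ m)"
    by (auto simp: real_polynomial_function_iff_sum)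
  show ?thesis
  proof (rule that[where c = c and N = N])
    fix x :: real assume x: "0 \<le> x"
    then have close: "\<bar>g (exp (- x)) - (\<Sum>m\<le>N. c m * exp (- x) ^ m)\<bar> < \<eta> / 2"
      using p(2)[of "exp (- x)"] by (simp add: cN)
    have "\<eta> / 2 + indicator {..L} x \<le> g (exp (- x))"
    proof (cases "x \<le> L")
      case True
      then have "r \<le> exp (- x)" by (simp add: r_def)
      then have "1 \<le> (exp (- x) - l) / (r - l)" using lr by (simp add: le_divide_eq)
      then show ?thesis using True by (simp add: g_def)
    qed (simp add: g_def)
    with close show "indicator {..L} x \<le> (\<Sum>m\<le>N. c m * exp (- x) ^ m)" by linarith
    have "g (exp (- x)) \<le> \<eta> / 2 + indicator {..L + 1} x"
    proof (cases "x \<le> L + 1")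
      case False
      then have "exp (- x) \<le> l" by (simp add: l_def)
      then have "(exp (- x) - l) / (r - l) \<le> 0" using lr by (simp add: divide_le_0_iff)
      then show ?thesis using False by (simp add: g_def)
    qed (simp add: g_def)
    with close show "(\<Sum>m\<le>N. c m * exp (- x) ^ m) \<le> indicator {..L + 1} x + \<eta>" by linarith
  qed
qed

subsection \<open>Upper bounds for the distribution function of a permanental vector\<close>

text \<open>For the Laplace transform \<open>\<phi>\<close> of a random vector \<open>X\<close>, the sum on the left is the expectation of
  \<open>\<Prod>i<n. p i (exp (- X i))\<close> with \<open>p i\<close> the polynomial with coefficients \<open>c i\<close>. As it is a finite sum,
  it commutes with pointwise limits of \<open>\<phi>\<close>, so no inversion of Laplace transforms is needed.\<close>

lemma gamma_cone_functional_bound: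
  fixes a \<theta> :: "nat \<Rightarrow> real" and c :: "nat \<Rightarrow> nat \<Rightarrow> real"
  assumes a: "\<And>i. i < n \<Longrightarrow> 0 < a i" and \<phi>: "gamma_cone a n \<alpha> n \<phi>"
    and c0: "\<And>i k. i < n \<Longrightarrow> 0 \<le> (\<Sum>m\<le>N. c i m * (a i + real m) powr (- (\<alpha> + real k)))"
    and c1: "\<And>i k. i < n \<Longrightarrow> (\<Sum>m\<le>N. c i m * (a i + real m) powr (- (\<alpha> + real k))) \<le> a i powr (- (\<alpha> + real k)) * \<theta> i"
  shows "(\<Sum>\<mu>\<in>{..<n} \<rightarrow>\<^sub>E {..N}. (\<Prod>i<n. c i (\<mu> i)) * \<phi> (\<lambda>i. real (\<mu> i))) \<le> (\<Prod>i<n. \<theta> i) * \<phi> (\<lambda>_. 0)"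
  using \<phi>
proof (induction rule: lim_cone.induct)
  case (base g)
  then obtain k where k: "g = (\<lambda>s. (\<Prod>i<n. (a i + s i) powr (- \<alpha>)) * (\<Prod>i<n. inverse (a i + s i) ^ k i))"
    by (auto simp: gamma_base_def)
  have g: "g s = (\<Prod>i<n. (a i + s i) powr (- (\<alpha> + real (k i))))" if "\<And>i. i < n \<Longrightarrow> 0 \<le> s i" for s
    unfolding k prod.distrib[symmetric]
  proof (rule prod.cong[OF refl])
    fix i assume "i \<in> {..<n}"
    then have "0 < a i + s i" using a[of i] that[of i] by simp
    then show "(a i + s i) powr (- \<alpha>) * inverse (a i + s i) ^ k i = (a i + s i) powr (- (\<alpha> + real (k i)))"
      by (simp add: powr_add powr_minus powr_realpow power_inverse powr_diff divide_inverse)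
  qed
  have "(\<Sum>\<mu>\<in>{..<n} \<rightarrow>\<^sub>E {..N}. (\<Prod>i<n. c i (\<mu> i)) * g (\<lambda>i. real (\<mu> i))) =
      (\<Sum>\<mu>\<in>{..<n} \<rightarrow>\<^sub>E {..N}. \<Prod>i<n. c i (\<mu> i) * (a i + real (\<mu> i)) powr (- (\<alpha> + real (k i))))"
    by (simp add: g prod.distrib)
  also have "\<dots> = (\<Prod>i<n. \<Sum>m\<le>N. c i m * (a i + real m) powr (- (\<alpha> + real (k i))))"
    by (rule prod_sum_PiE[symmetric]) auto
  \<comment> \<open>Upper bounds multiply only between non-negative factors; the lower bound
    \<open>c0\<close> supplies this.\<close>
  also have "\<dots> \<le> (\<Prod>i<n. a i powr (- (\<alpha> + real (k i))) * \<theta> i)"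
    using c0 c1 by (intro prod_mono) auto
  also have "\<dots> = (\<Prod>i<n. \<theta> i) * g (\<lambda>_. 0)"
    by (simp add: g prod.distrib mult.commute)
  finally show ?case .
next
  case (add f g)
  then show ?case by (simp add: distrib_left sum.distrib)
next
  case (scale r f)
  from mult_left_mono[OF scale.IH scale.hyps(1)] show ?case
    by (simp add: sum_distrib_left mult_ac)
next
  case (lim f g)
  have arg: "(\<lambda>i. real (\<mu> i)) \<in> nonneg_args n" for \<mu> :: "nat \<Rightarrow> nat"
    by (simp add: nonneg_args_def)
  have 0: "(\<lambda>_. 0) \<in> nonneg_args n" by (simp add: nonneg_args_def)
  show ?case
  proof (rule LIMSEQ_le)
    show "(\<lambda>k. \<Sum>\<mu>\<in>{..<n} \<rightarrow>\<^sub>E {..N}. (\<Prod>i<n. c i (\<mu> i)) * f k (\<lambda>i. real (\<mu> i))) \<longlonglongrightarrow>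
        (\<Sum>\<mu>\<in>{..<n} \<rightarrow>\<^sub>E {..N}. (\<Prod>i<n. c i (\<mu> i)) * g (\<lambda>i. real (\<mu> i)))"
      by (intro tendsto_sum tendsto_mult_left lim.hyps arg)
    show "(\<lambda>k. (\<Prod>i<n. \<theta> i) * f k (\<lambda>_. 0)) \<longlonglongrightarrow> (\<Prod>i<n. \<theta> i) * g (\<lambda>_. 0)"
      by (intro tendsto_mult_left lim.hyps 0)
  qed (use lim.IH in blast)
qed

text \<open>Moves the diagonal from the kernel to its inverse, where the sign pattern is
  available.\<close>

lemma det_one_plus_mult_diag:
  fixes A K :: "real mat"
  assumes A: "A \<in> carrier_mat n n" and K: "K \<in> carrier_mat n n" and AK: "A * K = 1\<^sub>m n"
  shows "Determinant.det A * Determinant.det (1\<^sub>m n + K * mat_diag n s) = Determinant.det (A + mat_diag n s)"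
proof -
  have "A * (1\<^sub>m n + K * mat_diag n s) = A + mat_diag n s"
    using A K by (simp add: mult_add_distrib_mat[where nr = n and n = n and nc = n] AK left_mult_one_mat[OF mat_diag_dim] flip: assoc_mult_mat[where ?n\<^sub>1 = n and ?n\<^sub>2 = n and ?n\<^sub>3 = n and ?n\<^sub>4 = n])
  then show ?thesis
    using A K by (subst det_mult[symmetric, of _ n]) auto
qed

text \<open>Expanding the product over multi-indices \<open>\<mu>\<close> leaves Laplace transforms
  at integer arguments, which the permanental property evaluates.\<close>

lemma permanental_expectation:
  fixes c :: "nat \<Rightarrow> nat \<Rightarrow> real"
  assumes X: "permanental_process M T \<alpha> u X" and t: "\<And>i. i < n \<Longrightarrow> t i \<in> T"
  shows "has_bochner_integral M (\<lambda>\<omega>. \<Prod>i<n. \<Sum>m\<le>N. c i m * exp (- X (t i) \<omega>) ^ m)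
    (\<Sum>\<mu>\<in>{..<n} \<rightarrow>\<^sub>E {..N}. (\<Prod>i<n. c i (\<mu> i)) *
      Determinant.det (1\<^sub>m n + kernel_mat u n t * mat_diag n (\<lambda>i. real (\<mu> i))) powr (- \<alpha>))"
proof -
  interpret prob_space M using X by (simp add: permanental_process_def)
  have Xm [measurable]: "X (t i) \<in> borel_measurable M" if "i < n" for i
    using X t[OF that] by (simp add: permanental_process_def)
  have X0: "0 \<le> X (t i) \<omega>" if "i < n" "\<omega> \<in> space M" for i \<omega>
    using X t[OF that(1)] that(2) by (simp add: permanental_process_def)
  have "has_bochner_integral M (\<lambda>\<omega>. exp (- (\<Sum>i<n. real (\<mu> i) * X (t i) \<omega>)))
      (Determinant.det (1\<^sub>m n + kernel_mat u n t * mat_diag n (\<lambda>i. real (\<mu> i))) powr (- \<alpha>))" for \<mu> :: "nat \<Rightarrow> nat"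
  proof -
    have "integrable M (\<lambda>\<omega>. exp (- (\<Sum>i<n. real (\<mu> i) * X (t i) \<omega>)))"
    proof (rule integrable_const_bound[where B = 1])
      show "AE \<omega> in M. norm (exp (- (\<Sum>i<n. real (\<mu> i) * X (t i) \<omega>))) \<le> 1"
        using X0 by (intro AE_I2) (auto intro!: sum_nonneg)
    qed (use Xm in measurable)
    then show ?thesis
      using X t by (auto simp: has_bochner_integral_iff permanental_process_def)
  qed
  then have "has_bochner_integral M
     (\<lambda>\<omega>. \<Sum>\<mu>\<in>{..<n} \<rightarrow>\<^sub>E {..N}. (\<Prod>i<n. c i (\<mu> i)) * exp (- (\<Sum>i<n. real (\<mu> i) * X (t i) \<omega>)))
     (\<Sum>\<mu>\<in>{..<n} \<rightarrow>\<^sub>E {..N}. (\<Prod>i<n. c i (\<mu> i)) *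
      Determinant.det (1\<^sub>m n + kernel_mat u n t * mat_diag n (\<lambda>i. real (\<mu> i))) powr (- \<alpha>))"
    by (intro has_bochner_integral_sum has_bochner_integral_mult_right) auto
  moreover have "(\<Sum>\<mu>\<in>{..<n} \<rightarrow>\<^sub>E {..N}. (\<Prod>i<n. c i (\<mu> i)) * exp (- (\<Sum>i<n. real (\<mu> i) * X (t i) \<omega>))) =
     (\<Prod>i<n. \<Sum>m\<le>N. c i m * exp (- X (t i) \<omega>) ^ m)" for \<omega>
    by (subst prod_sum_PiE)
       (simp_all add: prod.distrib exp_sum sum_negf[symmetric] flip: exp_of_nat_mult)
  ultimately show ?thesis by simp
qed

text \<open>The distribution of a permanental vector is a mixture of products of gamma laws with shapes
  \<open>\<alpha> + k\<^sub>i\<close> and rates \<open>A\<^sub>i\<^sub>i\<close>, so its components jointly dominate independent gamma variables.\<close>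

lemma permanental_upper_bound:
  fixes A :: "real mat"
  assumes X: "permanental_process M T \<alpha> u X" and \<alpha>: "0 < \<alpha>"
    and t: "\<And>i. i < n \<Longrightarrow> t i \<in> T"
    and A: "A \<in> carrier_mat n n" and AK: "A * kernel_mat u n t = 1\<^sub>m n"
    and diag: "\<And>i. i < n \<Longrightarrow> 0 < A $$ (i, i)"
    and off: "\<And>i j. i < n \<Longrightarrow> j < n \<Longrightarrow> i \<noteq> j \<Longrightarrow> A $$ (i, j) \<le> 0"
    and v: "\<And>i. i < n \<Longrightarrow> 0 < v i" "\<And>i. i < n \<Longrightarrow> 0 < (\<Sum>j<n. A $$ (i, j) * v j)"
    and I: "I \<subseteq> {..<n}" and \<delta>: "0 < \<delta>" and L: "0 < L"
    and tail: "\<And>i. i \<in> I \<Longrightarrow> \<delta> \<le> gamma_tail \<alpha> (A $$ (i, i) * (L + 1))"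
  shows "measure M {\<omega> \<in> space M. \<forall>i\<in>I. X (t i) \<omega> \<le> L} \<le> (1 - \<delta> / 2) ^ card I"
proof -
  interpret prob_space M using X by (simp add: permanental_process_def)
  have Xm [measurable]: "X (t i) \<in> borel_measurable M" if "i < n" for i
    using X t[OF that] by (simp add: permanental_process_def)
  have X0: "0 \<le> X (t i) \<omega>" if "i < n" "\<omega> \<in> space M" for i \<omega>
    using X t[OF that(1)] that(2) by (simp add: permanental_process_def)
  have [simp]: "finite I" using I finite_subset by blast
  define a where "a i = A $$ (i, i)" for i
  \<comment> \<open>The whole diagonal of A goes into a, so the induction starts from constant
    non-negative b with zero diagonal.\<close>
  define b where "b i j = (\<lambda>s::nat \<Rightarrow> real. if i = j then 0 else - A $$ (i, j))" for i j
  define \<phi> where "\<phi> s = Determinant.det (A + mat_diag n s) powr (- \<alpha>)" for s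
  have mat_eq: "Matrix.mat n n (\<lambda>(i, j). (if i = j then a i + s i else 0) - b i j s) = A + mat_diag n s" for s
    by (rule eq_matI) (use A in \<open>auto simp: mat_diag_def a_def b_def\<close>)
  have cone: "gamma_cone a n \<alpha> n (\<lambda>s. Determinant.det (Matrix.mat n n (\<lambda>(i, j). (if i = j then a i + s i else 0) - b i j s)) powr (- \<alpha>))
    \<and> (\<forall>s\<in>nonneg_args n. 0 < Determinant.det (Matrix.mat n n (\<lambda>(i, j). (if i = j then a i + s i else 0) - b i j s)))"
  proof (rule gamma_cone_det[OF \<alpha> _ order.refl])
    show "0 < a i" if "i < n" for i using diag[OF that] by (simp add: a_def)
    show "gamma_cone a n \<alpha> 0 (b i j)" if "i < n" "j < n" for i j
      unfolding b_def using off[OF that] by (intro gamma_cone_const) auto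
    fix s assume s: "s \<in> nonneg_args n"
    have "0 < (\<Sum>j<n. ((if i = j then a i + s i else 0) - b i j s) * v j)" if i: "i < n" for i
    proof -
      have "(\<Sum>j<n. ((if i = j then a i + s i else 0) - b i j s) * v j) =
          (\<Sum>j<n. A $$ (i, j) * v j + (if j = i then s i * v i else 0))"
        by (intro sum.cong) (auto simp: a_def b_def algebra_simps)
      also have "\<dots> = (\<Sum>j<n. A $$ (i, j) * v j) + s i * v i"
        using i by (simp add: sum.distrib)
      also have "\<dots> > 0"
        using v[OF i] s i by (auto simp: nonneg_args_def intro!: add_pos_nonneg)
      finally show ?thesis .
    qed
    then show "\<exists>v. \<forall>i<n. 0 < v i \<and> 0 < (\<Sum>j<n. ((if i = j then a i + s i else 0) - b i j s) * v j)"
      using v(1) by blast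
  qed
  then have \<phi>: "gamma_cone a n \<alpha> n \<phi>" and det_pos: "\<And>s. s \<in> nonneg_args n \<Longrightarrow> 0 < Determinant.det (A + mat_diag n s)"
    unfolding mat_eq \<phi>_def by auto
  have "A + mat_diag n (\<lambda>_. 0) = A"
    by (rule eq_matI) (use A in \<open>auto simp: mat_diag_def\<close>)
  with det_pos[of "\<lambda>_. 0"] have detA: "0 < Determinant.det A" by (simp add: nonneg_args_def)
  have \<phi>0: "\<phi> (\<lambda>_. 0) = Determinant.det A powr (- \<alpha>)"
    unfolding \<phi>_def \<open>A + mat_diag n (\<lambda>_. 0) = A\<close> ..
  obtain d N where d: "\<And>x. 0 \<le> x \<Longrightarrow> indicator {..L} x \<le> (\<Sum>m\<le>N. d m * exp (- x) ^ m)"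
    "\<And>x. 0 \<le> x \<Longrightarrow> (\<Sum>m\<le>N. d m * exp (- x) ^ m) \<le> indicator {..L + 1} x + \<delta> / 2"
    using exponential_polynomial_cutoff[OF L, of "\<delta> / 2"] \<delta> by auto
  \<comment> \<open>Coordinates outside I get the constant polynomial 1 and are integrated
    out.\<close>
  define c where "c i m = (if i \<in> I then d m else if m = 0 then 1 else 0)" for i m :: nat
  define \<theta> where "\<theta> i = (if i \<in> I then 1 - \<delta> / 2 else 1)" for i
  have c_I: "(\<Sum>m\<le>N. c i m * f m) = (\<Sum>m\<le>N. d m * f m)" if "i \<in> I" for i f
    using that by (simp add: c_def)
  have c_notI: "(\<Sum>m\<le>N. c i m * f m) = f 0" if "i \<notin> I" for i f
  proof -
    have "(\<Sum>m\<le>N. c i m * f m) = (\<Sum>m\<le>N. if m = 0 then f 0 else 0)"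
      using that by (intro sum.cong) (auto simp: c_def)
    then show ?thesis by simp
  qed
  have d0: "0 \<le> (\<Sum>m\<le>N. d m * exp (- x) ^ m)" if "0 \<le> x" for x
    using d(1)[OF that] by (rule order.trans[rotated]) simp
  have bound: "0 \<le> (\<Sum>m\<le>N. c i m * (a i + real m) powr (- (\<alpha> + real k))) \<and>
      (\<Sum>m\<le>N. c i m * (a i + real m) powr (- (\<alpha> + real k))) \<le> a i powr (- (\<alpha> + real k)) * \<theta> i"
    if i: "i < n" for i k
  proof (cases "i \<in> I")
    case True
    have ai: "0 < a i" using diag[OF i] by (simp add: a_def)
    have L1: "0 \<le> L + 1" and \<delta>2: "0 \<le> \<delta> / 2" using L \<delta> by auto
    have "a i powr (- (\<alpha> + real k)) * (1 - gamma_tail \<alpha> (a i * (L + 1)) + \<delta> / 2) \<le> a i powr (- (\<alpha> + real k)) * \<theta> i"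
      using tail[OF True] True by (intro mult_left_mono) (auto simp: \<theta>_def a_def)
    then show ?thesis
      using gamma_polynomial_bound[OF ai \<alpha> L1 \<delta>2 d0 d(2), of k] unfolding c_I[OF True]
      by (meson order.trans)
  qed (simp add: c_notI \<theta>_def)
  define Y where "Y \<omega> = (\<Prod>i<n. \<Sum>m\<le>N. c i m * exp (- X (t i) \<omega>) ^ m)" for \<omega>
  have hbY: "has_bochner_integral M Y (\<Sum>\<mu>\<in>{..<n} \<rightarrow>\<^sub>E {..N}. (\<Prod>i<n. c i (\<mu> i)) *
      Determinant.det (1\<^sub>m n + kernel_mat u n t * mat_diag n (\<lambda>i. real (\<mu> i))) powr (- \<alpha>))"
    unfolding Y_def using X t by (rule permanental_expectation)
  have factor: "indicator {..L} (X (t i) \<omega>) \<le> (\<Sum>m\<le>N. c i m * exp (- X (t i) \<omega>) ^ m)" 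
    "0 \<le> (\<Sum>m\<le>N. c i m * exp (- X (t i) \<omega>) ^ m)" if "i < n" "\<omega> \<in> space M" for i \<omega>
    using d(1)[OF X0[OF that]] d0[OF X0[OF that]]
    by (cases "i \<in> I"; simp add: c_I c_notI indicator_def)+
  have meas: "{\<omega> \<in> space M. \<forall>i\<in>I. X (t i) \<omega> \<le> L} \<in> sets M"
  proof -
    have "{\<omega> \<in> space M. X (t i) \<omega> \<le> L} \<in> sets M" if "i \<in> I" for i
      using Xm[of i] that I by auto
    then show ?thesis by (intro sets.sets_Collect_finite_All) auto
  qed
  have "measure M {\<omega> \<in> space M. \<forall>i\<in>I. X (t i) \<omega> \<le> L} = (\<integral>\<omega>. indicator {\<omega> \<in> space M. \<forall>i\<in>I. X (t i) \<omega> \<le> L} \<omega> \<partial>M)"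
    using meas by simp
  also have "\<dots> \<le> (\<integral>\<omega>. Y \<omega> \<partial>M)"
  proof (rule integral_mono)
    show "integrable M (indicator {\<omega> \<in> space M. \<forall>i\<in>I. X (t i) \<omega> \<le> L} :: _ \<Rightarrow> real)"
      using meas by (intro integrable_real_indicator) (auto simp: emeasure_eq_measure)
    show "integrable M Y" using hbY by (simp add: has_bochner_integral_iff)
    fix \<omega> assume \<omega>: "\<omega> \<in> space M"
    show "indicator {\<omega> \<in> space M. \<forall>i\<in>I. X (t i) \<omega> \<le> L} \<omega> \<le> Y \<omega>"
    proof (cases "\<forall>i\<in>I. X (t i) \<omega> \<le> L")
      case True
      have "1 \<le> (\<Sum>m\<le>N. c i m * exp (- X (t i) \<omega>) ^ m)" if "i < n" for i
        using factor(1)[OF that \<omega>] True by (cases "i \<in> I") (auto simp: c_notI)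
      then have "1 \<le> Y \<omega>" unfolding Y_def by (intro prod_ge_1) auto
      then show ?thesis by (simp add: indicator_def)
    next
      case False
      then show ?thesis
        using factor(2)[OF _ \<omega>] unfolding Y_def by (auto intro!: prod_nonneg)
    qed
  qed
  also have "\<dots> = (\<Sum>\<mu>\<in>{..<n} \<rightarrow>\<^sub>E {..N}. (\<Prod>i<n. c i (\<mu> i)) * (Determinant.det A powr \<alpha> * \<phi> (\<lambda>i. real (\<mu> i))))"
  proof -
    \<comment> \<open>The factor \<open>Determinant.det A powr \<alpha>\<close> normalizes
      \<open>\<phi>\<close> to the value 1 at 0, so it cancels at the end.\<close>
    have "Determinant.det (1\<^sub>m n + kernel_mat u n t * mat_diag n s) powr (- \<alpha>) = Determinant.det A powr \<alpha> * \<phi> s"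
      if "s \<in> nonneg_args n" for s
    proof -
      have "Determinant.det (A + mat_diag n s) = Determinant.det A * Determinant.det (1\<^sub>m n + kernel_mat u n t * mat_diag n s)"
        using det_one_plus_mult_diag[OF A _ AK] by (simp add: kernel_mat_def)
      moreover have "Determinant.det A powr \<alpha> * Determinant.det A powr (- \<alpha>) = 1"
        using detA by (simp flip: powr_add)
      ultimately show ?thesis
        by (simp add: \<phi>_def powr_mult flip: mult.assoc)
    qed
    then show ?thesis
      using hbY by (simp add: has_bochner_integral_iff nonneg_args_def)
  qed
  also have "\<dots> = Determinant.det A powr \<alpha> * (\<Sum>\<mu>\<in>{..<n} \<rightarrow>\<^sub>E {..N}. (\<Prod>i<n. c i (\<mu> i)) * \<phi> (\<lambda>i. real (\<mu> i)))"
    by (simp add: sum_distrib_left mult_ac)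
  also have "\<dots> \<le> Determinant.det A powr \<alpha> * ((\<Prod>i<n. \<theta> i) * \<phi> (\<lambda>_. 0))"
    using diag bound by (intro mult_left_mono gamma_cone_functional_bound[OF _ \<phi>]) (auto simp: a_def)
  also have "\<dots> = (\<Prod>i<n. \<theta> i)"
  proof -
    have "Determinant.det A powr \<alpha> * Determinant.det A powr (- \<alpha>) = 1"
      using detA by (simp flip: powr_add)
    then show ?thesis by (simp add: \<phi>0 mult.left_commute)
  qed
  also have "\<dots> = (1 - \<delta> / 2) ^ card I"
    unfolding \<theta>_def using I by (simp add: prod.If_cases Int_absorb1)
  finally show ?thesis .
qed

subsection \<open>Unboundedness\<close>

text \<open>Row i of A is the i-th unit vector minus the hitting weights \<open>h i\<close>, divided
  by \<open>e i\<close>. In probabilistic terms \<open>e i\<close> is the mean local time at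
  \<open>t i\<close> before any other point is hit, and the diagonal entry is its
  reciprocal.\<close>

lemma kernel_inverse:
  assumes u: "markov_potential_density T u" and t: "t \<in> distinct_tuples T n"
  shows "\<exists>A v. A \<in> carrier_mat n n \<and> A * kernel_mat u n t = 1\<^sub>m n \<and>
    (\<forall>i<n. inverse_diag u n t i = A $$ (i, i) \<and> 0 < A $$ (i, i) \<and>
      (\<forall>j<n. i \<noteq> j \<longrightarrow> A $$ (i, j) \<le> 0) \<and>
      0 < v i \<and> 0 < (\<Sum>j<n. A $$ (i, j) * v j))"
proof -
  let ?K = "kernel_mat u n t"
  have K: "?K \<in> carrier_mat n n" by (simp add: kernel_mat_def)
  have tT: "t i \<in> T" if "i < n" for i using t that by (auto simp: distinct_tuples_def)
  have inj: "inj_on t {..<n}" using t by (simp add: distinct_tuples_def)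
  have u0: "0 \<le> u (t i) (t j)" if "i < n" "j < n" for i j
    using markov_potential_density_nonneg[OF u tT tT] that .
  \<comment> \<open>With B empty the strict inequality of the decomposition says just this.\<close>
  have diag_pos: "0 < u (t i) (t i)" if "i < n" for i
    using markov_potential_density_decomposition[OF u tT[OF that], of "{}"] by simp
  have "\<exists>h. (\<forall>k<n. k \<noteq> i \<longrightarrow> 0 \<le> h k) \<and> (\<forall>j<n. j \<noteq> i \<longrightarrow> u (t i) (t j) = (\<Sum>k\<in>{..<n} - {i}. h k * u (t k) (t j))) \<and>
      (\<Sum>k\<in>{..<n} - {i}. h k * u (t k) (t i)) < u (t i) (t i)" if i: "i < n" for i
  proof -
    let ?B = "t ` ({..<n} - {i})"
    have "t i \<notin> ?B" using inj i by (auto simp: inj_on_def)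
    moreover have "?B \<subseteq> T" using tT by auto
    ultimately obtain h where h: "\<forall>z\<in>?B. 0 \<le> h z" "\<forall>y\<in>?B. u (t i) y = (\<Sum>z\<in>?B. h z * u z y)"
        "(\<Sum>z\<in>?B. h z * u z (t i)) < u (t i) (t i)"
      using markov_potential_density_decomposition[OF u tT[OF i], of ?B] by auto
    have inj': "inj_on t ({..<n} - {i})" using inj by (rule inj_on_subset) auto
    show ?thesis
      using h by (intro exI[of _ "h \<circ> t"]) (simp add: sum.reindex[OF inj'])
  qed
  then have "\<forall>i. \<exists>h. i < n \<longrightarrow> (\<forall>k<n. k \<noteq> i \<longrightarrow> 0 \<le> h k) \<and>
      (\<forall>j<n. j \<noteq> i \<longrightarrow> u (t i) (t j) = (\<Sum>k\<in>{..<n} - {i}. h k * u (t k) (t j))) \<and>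
      (\<Sum>k\<in>{..<n} - {i}. h k * u (t k) (t i)) < u (t i) (t i)"
    by blast
  from choice[OF this] obtain h where h0: "\<And>i k. i < n \<Longrightarrow> k < n \<Longrightarrow> k \<noteq> i \<Longrightarrow> 0 \<le> h i k"
    and h: "\<And>i j. i < n \<Longrightarrow> j < n \<Longrightarrow> j \<noteq> i \<Longrightarrow> u (t i) (t j) = (\<Sum>k\<in>{..<n} - {i}. h i k * u (t k) (t j))"
    and hi: "\<And>i. i < n \<Longrightarrow> (\<Sum>k\<in>{..<n} - {i}. h i k * u (t k) (t i)) < u (t i) (t i)"
    by blast
  define e where "e i = u (t i) (t i) - (\<Sum>k\<in>{..<n} - {i}. h i k * u (t k) (t i))" for i
  have e: "0 < e i" if "i < n" for i using hi[OF that] by (simp add: e_def)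
  define A where "A = Matrix.mat n n (\<lambda>(i, k). (if k = i then 1 else - h i k) / e i)"
  have A: "A \<in> carrier_mat n n" by (simp add: A_def)
  have entry: "(\<Sum>k<n. A $$ (i, k) * u (t k) (t j)) = (if i = j then 1 else 0)" if ij: "i < n" "j < n" for i j
  proof -
    have "(\<Sum>k<n. A $$ (i, k) * u (t k) (t j)) = (\<Sum>k<n. (if k = i then 1 else - h i k) * u (t k) (t j)) / e i"
      unfolding sum_divide_distrib using ij by (intro sum.cong) (auto simp: A_def)
    also have "(\<Sum>k<n. (if k = i then 1 else - h i k) * u (t k) (t j)) =
        u (t i) (t j) - (\<Sum>k\<in>{..<n} - {i}. h i k * u (t k) (t j))"
      using ij by (subst sum.remove[of _ i]) (auto simp: sum_negf[symmetric] intro!: sum.cong)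
    also have "\<dots> = (if i = j then e i else 0)"
      using h[OF ij] by (auto simp: e_def)
    finally show ?thesis using e[OF ij(1)] by (cases "i = j") simp_all
  qed
  have AK: "A * ?K = 1\<^sub>m n"
    by (rule eq_matI) (use A entry in \<open>auto simp: kernel_mat_def scalar_prod_def atLeast0LessThan\<close>)
  have KA: "?K * A = 1\<^sub>m n"
    using mat_mult_left_right_inverse[OF A K AK] .
  have "mat_inverse ?K \<noteq> None"
  proof
    assume "mat_inverse ?K = None"
    then have "?K \<notin> Units (ring_mat TYPE(real) n ())" by (rule mat_inverse(1)[OF K])
    then show False using A K AK KA by (auto simp: Units_def ring_mat_def)
  qed
  then obtain B where B: "mat_inverse ?K = Some B" by blast
  have "B = A"
  proof -
    have "?K * B = 1\<^sub>m n" "B \<in> carrier_mat n n" using mat_inverse(2)[OF K B] by auto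
    then have "A = A * (?K * B)" using A by simp
    also have "\<dots> = A * ?K * B" using A K \<open>B \<in> carrier_mat n n\<close> by (intro assoc_mult_mat[symmetric]) auto
    also have "\<dots> = B" using AK \<open>B \<in> carrier_mat n n\<close> by simp
    finally show ?thesis ..
  qed
  \<comment> \<open>The row sums of the kernel: A maps them to the all-ones vector, which witnesses
    semipositivity.\<close>
  define v where "v k = (\<Sum>j<n. u (t k) (t j))" for k
  show ?thesis
  proof (intro exI[of _ A] exI[of _ v] conjI A AK allI impI)
    show "inverse_diag u n t i = A $$ (i, i)" for i
      by (simp add: inverse_diag_def B \<open>B = A\<close>)
    show "0 < A $$ (i, i)" if "i < n" for i using that e by (simp add: A_def)
    show "A $$ (i, j) \<le> 0" if "i < n" "j < n" "i \<noteq> j" for i j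
      using that h0[of i j] e[of i] by (simp add: A_def)
    show "0 < v i" if "i < n" for i
      unfolding v_def using that diag_pos u0 by (intro sum_pos2[of _ i]) auto
    show "0 < (\<Sum>j<n. A $$ (i, j) * v j)" if i: "i < n" for i
    proof -
      have "(\<Sum>k<n. A $$ (i, k) * v k) = (\<Sum>j<n. \<Sum>k<n. A $$ (i, k) * u (t k) (t j))"
        unfolding v_def sum_distrib_left by (rule sum.swap)
      also have "\<dots> = 1" using entry i by simp
      finally show ?thesis by simp
    qed
  qed
qed

section \<open>Elementary estimates for the choice of constants\<close>

lemma power_one_minus_le_exp:
  assumes "0 \<le> x" "x \<le> 1"
  shows "(1 - x) ^ k \<le> exp (- (real k * x))"
proof -
  have "(1 - x) ^ k \<le> exp (- x) ^ k"
    using assms exp_ge_add_one_self[of "- x"] by (intro power_mono) auto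
  then show ?thesis by (simp flip: exp_of_nat_mult)
qed

lemma gamma_tail_le_1:
  assumes "0 < \<beta>"
  shows "gamma_tail \<beta> x \<le> 1"
proof -
  have "(\<integral>y. gamma_weight \<beta> y * indicator {x<..} y \<partial>lborel) \<le> (\<integral>y. gamma_weight \<beta> y \<partial>lborel)"
    using assms gamma_weight_integral[OF assms]
    by (intro integral_mono gamma_weight_integrable[where C = 1])
       (auto simp: indicator_def has_bochner_integral_iff gamma_weight_nonneg)
  then show ?thesis
    using Gamma_real_pos[OF assms] gamma_weight_integral[OF assms]
    by (simp add: gamma_tail_def has_bochner_integral_iff)
qed

text \<open>Number of good indices times the order n^(-1/2) of each exceedance probability. Rounding
  in \<open>n div p\<close> loses less than 1.\<close>

lemma div_sqrt_tendsto_infinity: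
  assumes "1 \<le> (p::nat)" "0 < (r::real)"
  shows "filterlim (\<lambda>n. real (n div p) * (r / sqrt (real n))) at_top sequentially"
proof (rule filterlim_at_top_mono)
  show "filterlim (\<lambda>n. (real n / real p - 1) * (r / sqrt (real n))) at_top sequentially"
    using assms by real_asymp
  show "\<forall>\<^sub>F n in sequentially. (real n / real p - 1) * (r / sqrt (real n)) \<le> real (n div p) * (r / sqrt (real n))"
  proof (intro always_eventually allI mult_right_mono)
    fix n
    have "n < (n div p + 1) * p" using assms by (simp add: dividend_less_div_times add.commute)
    then have "real n < (real (n div p) + 1) * real p" by (metis of_nat_less_iff of_nat_mult of_nat_add of_nat_1)
    then show "real n / real p - 1 \<le> real (n div p)" using assms by (simp add: divide_simps algebra_simps)
  qed (use assms in auto)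
qed

text \<open>With \<open>q = (d\<^sub>n\<^sup>*)\<^sup>2 log n\<close> large, at least \<open>n div p\<close> of the components of
  \<open>X\<close> dominate independent gamma variables of rate at most \<open>C' log n / q\<close>, each of which exceeds
  a given level with probability at least of order \<open>n\<^sup>-\<^sup>1\<^sup>/\<^sup>2\<close>.\<close>

lemma permanental_bounded_null:
  fixes d :: "'a \<Rightarrow> 'a \<Rightarrow> real"
  assumes \<alpha>: "0 < \<alpha>" and ap: "associated_permanental_process M T \<alpha> u X"
    and p: "1 \<le> p"
    and diag: "\<And>n t. p \<le> n \<Longrightarrow> 2 \<le> n \<Longrightarrow> t \<in> distinct_tuples T n \<Longrightarrow>
           n div p \<le> card {i. i < n \<and>
             (dstar d n t = 0 \<or> inverse_diag u n t i \<le> C' / (dstar d n t)\<^sup>2)}"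
    and lim: "limsup (\<lambda>n. (SUP t\<in>distinct_tuples T n. ennreal ((dstar d n t)\<^sup>2)) * ennreal (ln (real n))) = \<infinity>"
    and L: "0 < L"
  shows "measure M {\<omega> \<in> space M. \<forall>t\<in>T. X t \<omega> \<le> L} \<le> 0"
proof (rule field_le_epsilon)
  fix \<epsilon> :: real assume \<epsilon>: "0 < \<epsilon>"
  have X: "permanental_process M T \<alpha> u X" and u: "markov_potential_density T u"
    using ap by (auto simp: associated_permanental_process_def)
  interpret prob_space M using X by (simp add: permanental_process_def)
  \<comment> \<open>Half the constant of \<open>gamma_tail_lower_bound\<close>, so that
    \<open>\<delta> / 2\<close> in \<open>permanental_upper_bound\<close> becomes
    \<open>r / sqrt (real n)\<close>.\<close>
  define r where "r = exp (- 4) / Gamma \<alpha> / 2"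
  have r: "0 < r" using Gamma_real_pos[OF \<alpha>] by (simp add: r_def)
  have "\<forall>\<^sub>F n in sequentially. - ln \<epsilon> \<le> real (n div p) * (r / sqrt (real n))"
    using div_sqrt_tendsto_infinity[OF p r] by (auto simp: filterlim_at_top)
  then obtain n0 where n0: "\<And>n. n0 \<le> n \<Longrightarrow> - ln \<epsilon> \<le> real (n div p) * (r / sqrt (real n))"
    by (auto simp: eventually_sequentially)
  define Q where "Q = 4 * (\<bar>C'\<bar> + 1) * (L + 1)"
  have Q: "0 < Q" using L by (simp add: Q_def)
  have "\<exists>\<^sub>F n in sequentially. ennreal Q < (SUP t\<in>distinct_tuples T n. ennreal ((dstar d n t)\<^sup>2)) * ennreal (ln (real n))"
  proof (rule ccontr)
    assume "\<not> ?thesis"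
    then have "\<forall>\<^sub>F n in sequentially. (SUP t\<in>distinct_tuples T n. ennreal ((dstar d n t)\<^sup>2)) * ennreal (ln (real n)) \<le> ennreal Q"
      by (simp add: not_frequently not_less)
    then have "limsup (\<lambda>n. (SUP t\<in>distinct_tuples T n. ennreal ((dstar d n t)\<^sup>2)) * ennreal (ln (real n))) \<le> ennreal Q"
      by (rule Limsup_bounded)
    then show False using lim by (simp add: top_unique)
  qed
  then have "\<exists>n\<ge>max n0 (max p 2). ennreal Q < (SUP t\<in>distinct_tuples T n. ennreal ((dstar d n t)\<^sup>2)) * ennreal (ln (real n))"
    unfolding frequently_sequentially by blast
  then obtain n where n: "n0 \<le> n" "p \<le> n" "2 \<le> n"
    and Qn: "ennreal Q < (SUP t\<in>distinct_tuples T n. ennreal ((dstar d n t)\<^sup>2)) * ennreal (ln (real n))"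
    by auto
  have ln: "0 < ln (real n)" using n by simp
  obtain t where t: "t \<in> distinct_tuples T n" and Qt: "Q < (dstar d n t)\<^sup>2 * ln (real n)"
  proof -
    have "ennreal Q < (SUP t\<in>distinct_tuples T n. ennreal ((dstar d n t)\<^sup>2) * ennreal (ln (real n)))"
      using Qn by (simp add: SUP_mult_right_ennreal)
    then obtain t where "t \<in> distinct_tuples T n" "ennreal Q < ennreal ((dstar d n t)\<^sup>2) * ennreal (ln (real n))"
      by (auto simp: less_SUP_iff)
    then show ?thesis
      using that ln Q by (simp add: ennreal_less_iff flip: ennreal_mult)
  qed
  \<comment> \<open>Positivity of Q excludes \<open>dstar d n t = 0\<close>, so the indices counted
    in the hypothesis all satisfy the genuine inequality.\<close>
  have ds: "0 < (dstar d n t)\<^sup>2"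
  proof -
    have "dstar d n t \<noteq> 0" using Qt Q by auto
    then show ?thesis by simp
  qed
  obtain A v where A: "A \<in> carrier_mat n n" "A * kernel_mat u n t = 1\<^sub>m n"
    and inv: "\<And>i. i < n \<Longrightarrow> inverse_diag u n t i = A $$ (i, i)" 
    and Apos: "\<And>i. i < n \<Longrightarrow> 0 < A $$ (i, i)"
    and off: "\<And>i j. i < n \<Longrightarrow> j < n \<Longrightarrow> i \<noteq> j \<Longrightarrow> A $$ (i, j) \<le> 0"
    and v: "\<And>i. i < n \<Longrightarrow> 0 < v i" "\<And>i. i < n \<Longrightarrow> 0 < (\<Sum>j<n. A $$ (i, j) * v j)"
    using kernel_inverse[OF u t] by (elim exE conjE) blast
  define I where "I = {i. i < n \<and> inverse_diag u n t i \<le> C' / (dstar d n t)\<^sup>2}"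
  have cardI: "n div p \<le> card I"
    using diag[OF n(2,3) t] ds by (simp add: I_def)
  have small: "A $$ (i, i) * (L + 1) \<le> ln (real n) / 4" if "i \<in> I" for i
  proof -
    have "A $$ (i, i) \<le> C' / (dstar d n t)\<^sup>2" using that inv[of i] by (simp add: I_def)
    also have "\<dots> \<le> (\<bar>C'\<bar> + 1) / (dstar d n t)\<^sup>2" using ds by (intro divide_right_mono) auto
    also have "\<dots> \<le> (\<bar>C'\<bar> + 1) * ln (real n) / Q"
    proof -
      have "1 / (dstar d n t)\<^sup>2 \<le> ln (real n) / Q"
        using Qt Q ds by (simp add: divide_simps mult.commute less_imp_le)
      from mult_left_mono[OF this, of "\<bar>C'\<bar> + 1"] show ?thesis by simp
    qed
    also have "\<dots> = ln (real n) / (4 * (L + 1))"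
    proof -
      have Q': "Q = (\<bar>C'\<bar> + 1) * (4 * (L + 1))" by (simp add: Q_def algebra_simps)
      have "\<bar>C'\<bar> + 1 \<noteq> 0" by linarith
      then show ?thesis unfolding Q' by (rule mult_divide_mult_cancel_left)
    qed
    finally show ?thesis using L by (simp add: field_simps)
  qed
  define \<delta> where "\<delta> = 2 * (r / sqrt (real n))"
  have \<delta>: "0 < \<delta>" using r n by (simp add: \<delta>_def)
  have tail: "\<delta> \<le> gamma_tail \<alpha> (A $$ (i, i) * (L + 1))" if i: "i \<in> I" for i
  proof -
    let ?x = "A $$ (i, i) * (L + 1)"
    have "0 \<le> ?x" using Apos[of i] i L by (auto simp: I_def)
    have "inverse (sqrt (real n)) = exp (- (ln (real n) / 2))"
      using n by (simp add: exp_minus flip: ln_sqrt)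
    also have "\<dots> \<le> exp (- 2 * ?x)" using small[OF i] by simp
    finally have "exp (- 4) / Gamma \<alpha> * inverse (sqrt (real n)) \<le> exp (- 4) / Gamma \<alpha> * exp (- 2 * ?x)"
      using Gamma_real_pos[OF \<alpha>] by (intro mult_left_mono) auto
    also have "\<dots> \<le> gamma_tail \<alpha> ?x" using \<alpha> \<open>0 \<le> ?x\<close> by (rule gamma_tail_lower_bound)
    also have "exp (- 4) / Gamma \<alpha> * inverse (sqrt (real n)) = \<delta>"
      by (simp add: \<delta>_def r_def inverse_eq_divide)
    finally show ?thesis .
  qed
  have tT: "t i \<in> T" if "i < n" for i using t that by (auto simp: distinct_tuples_def)
  have I: "I \<subseteq> {..<n}" by (auto simp: I_def)
  \<comment> \<open>A single good index shows \<open>\<delta> \<le> 1\<close>, so that fewer factors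
    1 - \<open>\<delta> / 2\<close> give a larger product.\<close>
  have "1 \<le> n div p" using n p by (simp add: div_greater_zero_iff Suc_le_eq)
  then obtain i0 where "i0 \<in> I" using cardI by (cases "I = {}") auto
  then have \<delta>1: "\<delta> \<le> 1" using tail gamma_tail_le_1[OF \<alpha>] order.trans by blast
  have "measure M {\<omega> \<in> space M. \<forall>t\<in>T. X t \<omega> \<le> L} \<le> measure M {\<omega> \<in> space M. \<forall>i\<in>I. X (t i) \<omega> \<le> L}"
  proof (rule finite_measure_mono)
    show "{\<omega> \<in> space M. \<forall>i\<in>I. X (t i) \<omega> \<le> L} \<in> sets M"
    proof (intro sets.sets_Collect_finite_All)
      show "{\<omega> \<in> space M. X (t i) \<omega> \<le> L} \<in> sets M" if "i \<in> I" for i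
      proof -
        have [measurable]: "X (t i) \<in> borel_measurable M"
          using X tT that I by (auto simp: permanental_process_def)
        show ?thesis by measurable
      qed
    qed (use I finite_subset in blast)
  qed (use tT I in auto)
  also have "\<dots> \<le> (1 - \<delta> / 2) ^ card I"
    using permanental_upper_bound[OF X \<alpha> tT A Apos off v I \<delta> L tail] .
  also have "\<dots> \<le> (1 - \<delta> / 2) ^ (n div p)"
    using \<delta> \<delta>1 cardI by (intro power_decreasing) auto
  also have "\<dots> \<le> exp (- (real (n div p) * (\<delta> / 2)))"
    using \<delta> \<delta>1 by (intro power_one_minus_le_exp) auto
  also have "\<dots> \<le> exp (ln \<epsilon>)" using n0[OF n(1)] by (simp add: \<delta>_def)
  also have "\<dots> = 0 + \<epsilon>" using \<epsilon> by simp
  finally show "measure M {\<omega> \<in> space M. \<forall>t\<in>T. X t \<omega> \<le> L} \<le> 0 + \<epsilon>" .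
qed

theorem corollary1p1:
  fixes T :: "'a set" and \<alpha> :: real and u :: "'a \<Rightarrow> 'a \<Rightarrow> real"
    and M :: "'w measure" and X :: "'a \<Rightarrow> 'w \<Rightarrow> real"
    and d :: "'a \<Rightarrow> 'a \<Rightarrow> real" and C' :: real and p :: nat
  assumes "countable T"
    and "0 < \<alpha>"
    and "associated_permanental_process M T \<alpha> u X"
    and "\<And>s t. s \<in> T \<Longrightarrow> t \<in> T \<Longrightarrow> 0 \<le> d s t"
    and "1 \<le> p"
    and "\<And>n t. p \<le> n \<Longrightarrow> 2 \<le> n \<Longrightarrow> t \<in> distinct_tuples T n \<Longrightarrow>
           n div p \<le> card {i. i < n \<and>
             (dstar d n t = 0 \<or> inverse_diag u n t i \<le> C' / (dstar d n t)\<^sup>2)}"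
    and "limsup (\<lambda>n. (SUP t\<in>distinct_tuples T n. ennreal ((dstar d n t)\<^sup>2)) * ennreal (ln (real n)))
           = \<infinity>"
  shows "AE \<omega> in M. (SUP t\<in>T. ereal (X t \<omega>)) = \<infinity>"
proof -
  have X: "permanental_process M T \<alpha> u X"
    using assms(3) by (simp add: associated_permanental_process_def)
  interpret prob_space M using X by (simp add: permanental_process_def)
  \<comment> \<open>The levels are \<open>Suc k\<close> because
    \<open>permanental_bounded_null\<close> is stated for positive levels; countably many suffice to
    exclude every finite supremum.\<close>
  have "AE \<omega> in M. \<not> (\<forall>t\<in>T. X t \<omega> \<le> real (Suc k))" for k
  proof -
    have "measure M {\<omega> \<in> space M. \<forall>t\<in>T. X t \<omega> \<le> real (Suc k)} = 0"
      using permanental_bounded_null[OF assms(2,3,5-7), of "real (Suc k)"]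
      by (intro antisym) auto
    moreover have "{\<omega> \<in> space M. \<forall>t\<in>T. X t \<omega> \<le> real (Suc k)} \<in> sets M"
    proof (rule sets.sets_Collect_countable_All'[OF _ assms(1)])
      fix t assume "t \<in> T"
      then have [measurable]: "X t \<in> borel_measurable M"
        using X by (simp add: permanental_process_def)
      show "{\<omega> \<in> space M. X t \<omega> \<le> real (Suc k)} \<in> sets M" by measurable
    qed
    ultimately show ?thesis
      by (intro AE_I[of _ _ "{\<omega> \<in> space M. \<forall>t\<in>T. X t \<omega> \<le> real (Suc k)}"])
         (auto simp: emeasure_eq_measure)
  qed
  then have "AE \<omega> in M. \<forall>k. \<not> (\<forall>t\<in>T. X t \<omega> \<le> real (Suc k))"
    by (simp add: AE_all_countable)
  then show ?thesis
  proof eventually_elim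
    case (elim \<omega>)
    have "ereal (real k) \<le> (SUP t\<in>T. ereal (X t \<omega>))" for k
    proof -
      obtain t where "t \<in> T" "\<not> X t \<omega> \<le> real (Suc k)" using elim[THEN spec, of k] by blast
      then show ?thesis by (intro SUP_upper2[of t]) simp_all
    qed
    note le = this
    show ?case
    proof (rule ereal_top)
      fix b :: real
      obtain k :: nat where "b \<le> real k" using real_arch_simple by blast
      then show "ereal b \<le> (SUP t\<in>T. ereal (X t \<omega>))" using le[of k] by (intro order.trans[OF _ le[of k]]) simp
    qed
  qed
qed

end
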